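(* For every prime power $q>7$, $M(q+1,q-4)\ge \mathcal{T}_3(q)+\max\{N^m_{3,2}(q),N_{3,0}(q)\}$, where $$\mathcal{T}_3(q)+\max\{N^m_{3,2}(q),N_{3,0}(q)\}=\begin{cases} \frac32(q^3-q), & q\equiv 0 \pmod 3,\\ \frac12(3q^3-q^2-2q), & q \text{ odd},\ q\equiv 1\pmod 3,\\ \frac12(5q^3-q^2-4q), & q \text{ even},\ q\equiv 1\pmod 3,\\ 2q^3-q^2-q, & q \text{ odd},\ q\equiv 2\pmod 3,\\ 3q^3-q^2-2q, & q \text{ even},\ q\equiv 2\pmod 3. \end{cases}$$
   Context: For permutations $\pi,\sigma$ of the same $n$ symbols, the Hamming distance $hd(\pi,\sigma)$ is the number of positions $x$ with $\pi(x)\ne\sigma(x)$. $M(n,D)$ is the maximum size of a set of permutations on $n$ symbols in which any two distinct permutations have Hamming distance at least $D$. Let $q$ be a prime power, $\mathbb{F}_q$ the field with $q$ elements and $\mathcal{P}^1(\mathbb{F}_q)=\mathbb{F}_q\cup\{\infty\}$. Let $V,U$ be nonzero polynomials over $\mathbb{F}_q$ with $\gcd(V,U)=1$, of degrees $v,u$ and leading coefficients $a_v,b_u$. The rational function $V(x)/U(x)$ is evaluated on $\mathcal{P}^1(\mathbb{F}_q)$ as follows: at $a\in\mathbb{F}_q$ its value is $V(a)/U(a)$, understood as $\infty$ if $U(a)=0$; at $\infty$ its value is $\infty$ if $v>u$, $0$ if $v<u$, and $a_v/b_v$ if $v=u$. It is a permutation rational function (PRF) if it permutes $\mathcal{P}^1(\mathbb{F}_q)$.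 $P_{v,u}(q)$ is the set of PRFs $V(x)/U(x)$ (as rational functions, so $V/U$ and $(cV)/(cU)$ with $c\in\mathbb{F}_q\setminus\{0\}$ are the same element) with $\deg V=v$ and $\deg U=u$, and $N_{v,u}(q)=|P_{v,u}(q)|$. $N^m_{v,u}(q)$ is the number of PRFs $V(x)/U(x)$ in $P_{v,u}(q)$ with both $V$ and $U$ monic. $\mathcal{T}_3(q)=\sum N_{v,u}(q)$, the sum being over all pairs $(v,u)$ with $0\le v,u\le 2$. *)

theory Defs
  imports
    "HOL-Computational_Algebra.Computational_Algebra"
    "HOL-Number_Theory.Prime_Powers"
    "HOL-Combinatorics.Permutations"
begin

section \<open>Permutation arrays\<close>

definition hamming_dist :: "nat \<Rightarrow> (nat \<Rightarrow> nat) \<Rightarrow> (nat \<Rightarrow> nat) \<Rightarrow> nat" where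
  "hamming_dist n \<pi> \<sigma> = card {x \<in> {..<n}. \<pi> x \<noteq> \<sigma> x}"

definition permutation_array :: "nat \<Rightarrow> nat \<Rightarrow> (nat \<Rightarrow> nat) set \<Rightarrow> bool" where
  "permutation_array n D A \<longleftrightarrow>
     (\<forall>\<pi>\<in>A. \<pi> permutes {..<n}) \<and>
     (\<forall>\<pi>\<in>A. \<forall>\<sigma>\<in>A. \<pi> \<noteq> \<sigma> \<longrightarrow> D \<le> hamming_dist n \<pi> \<sigma>)"

text \<open>The set below is nonempty (take the empty array) and bounded by \<open>n!\<close>, so
  \<^term>\<open>Max\<close> is meaningful.\<close>

definition M :: "nat \<Rightarrow> nat \<Rightarrow> nat" where
  "M n D = Max {card A |A. permutation_array n D A}"


section \<open>Permutation rational functions\<close>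

text \<open>The projective line over a field \<^typ>\<open>'a\<close> is \<^typ>\<open>'a option\<close>, with
  \<^term>\<open>None\<close> as the point at infinity.\<close>

definition ratfun_eval :: "'a::field poly \<Rightarrow> 'a poly \<Rightarrow> 'a option \<Rightarrow> 'a option" where
  "ratfun_eval V U x =
     (case x of
        Some a \<Rightarrow> if poly U a = 0 then None else Some (poly V a / poly U a)
      | None \<Rightarrow> if degree V > degree U then None
                else if degree V < degree U then Some 0
                else Some (lead_coeff V / lead_coeff U))"

definition is_PRF :: "'a::field poly \<Rightarrow> 'a poly \<Rightarrow> bool" where
  "is_PRF V U \<longleftrightarrow> V \<noteq> 0 \<and> U \<noteq> 0 \<and> coprime V U \<and> bij (ratfun_eval V U)"

text \<open>Elements are taken in the field of fractions, which identifies \<open>V/U\<close> with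
  \<open>(cV)/(cU)\<close>.\<close>

definition PRF :: "nat \<Rightarrow> nat \<Rightarrow> 'a::field poly fract set" where
  "PRF v u = {Fract V U |V U. is_PRF V U \<and> degree V = v \<and> degree U = u}"

definition monic_PRF :: "nat \<Rightarrow> nat \<Rightarrow> 'a::field poly fract set" where
  "monic_PRF v u =
     {Fract V U |V U. is_PRF V U \<and> degree V = v \<and> degree U = u \<and>
        lead_coeff V = 1 \<and> lead_coeff U = 1}"

text \<open>The counts are functions of the field, given by its type.\<close>

definition N :: "'a::field itself \<Rightarrow> nat \<Rightarrow> nat \<Rightarrow> nat" where
  "N _ v u = card (PRF v u :: 'a poly fract set)"

definition N_monic :: "'a::field itself \<Rightarrow> nat \<Rightarrow> nat \<Rightarrow> nat" where
  "N_monic _ v u = card (monic_PRF v u :: 'a poly fract set)"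

definition T3 :: "'a::field itself \<Rightarrow> nat" where
  "T3 F = (\<Sum>(v, u)\<in>{0..2} \<times> {0..2}. N F v u)"

end

theory Submission imports Defs
begin

text \<open>
  The lower bound rests on the fact that \<open>V/U\<close> and \<open>V'/U'\<close> agree at a finite point only if that point
  is a root of \<open>V U' - V' U\<close>. This polynomial has degree at most 4 for two functions of degree at most 2
  and for two monic functions of type \<open>(3, 2)\<close> (\<open>V\<close> cubic, \<open>U\<close> quadratic), where the leading terms cancel; when one function has
  degree 3 and the other at most 2 its degree can be 5, but then the two differ at infinity. Hence there
  are at most 5 agreements among \<open>q + 1\<close> points.

  Counting the functions of type \<open>(3, 2)\<close> needs no estimate for points on curves. The denominator is
  \<open>U = x\<^sup>2 + t x + n\<close> without roots, and the function is \<open>x + c + (\<alpha> x + \<beta>) / U\<close>. Write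
  \<open>D = t\<^sup>2 - 4 n\<close>. The choice \<open>x + c - D U' / U\<close> is always injective. Conversely, the sum of
  the values of an injective function vanishes, which forces \<open>(\<alpha> x + \<beta>) / U = \<gamma> U' / U\<close>.
  The vanishing of the sum of the squares (of the cubes in characteristic 2) is then, for \<open>\<gamma> \<noteq> 0\<close>,
  a linear equation in \<open>\<gamma>\<close>, and the known solution \<open>- D\<close> shows that it is nondegenerate. So there is
  exactly one function for every \<open>U\<close> and \<open>c\<close>. Cubic polynomials outside characteristic 3 are treated with
  power sums in the same way, the exponent being \<open>(q - 1) / 3\<close> or \<open>(q + 1) / 3\<close>.
\<close>

section \<open>Power sums over finite fields\<close>

lemma sum_UNIV_inj:
  fixes f :: "'a::finite \<Rightarrow> 'a"
  assumes "inj f"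
  shows "(\<Sum>x\<in>UNIV. h (f x)) = sum h UNIV"
  using assms by (intro sum.reindex_bij_betw) (simp add: bij_betw_def finite_UNIV_inj_surj)

text \<open>The shift by 1 permutes the field, so adding 1 to every element leaves the total sum
  unchanged.\<close>

lemma of_nat_card_UNIV_eq_0: "of_nat (card (UNIV :: 'a::{field,finite} set)) = (0 :: 'a)"
proof -
  have "(\<Sum>x\<in>UNIV. x + 1 :: 'a) = (\<Sum>x\<in>UNIV. x)"
    by (rule sum_UNIV_inj[of "\<lambda>x. x + 1"]) (auto intro: injI)
  then show ?thesis by (simp add: sum.distrib)
qed

lemma one_less_card_UNIV: "1 < card (UNIV :: 'a::{field,finite} set)"
proof -
  have "card {0, 1 :: 'a} \<le> card (UNIV :: 'a set)" by (rule card_mono) auto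
  then show ?thesis by simp
qed

lemma power_card_minus_1_eq_1:
  fixes x :: "'a::{field,finite}"
  assumes "x \<noteq> 0"
  shows "x ^ (card (UNIV :: 'a set) - 1) = 1"
proof -
  have "(\<Prod>y\<in>UNIV-{0}. x * y) = (\<Prod>y\<in>UNIV-{0}. y)"
    by (rule prod.reindex_bij_witness[of _ "\<lambda>y. y / x" "\<lambda>y. x * y"]) (use assms in auto)
  then have "x ^ (card (UNIV :: 'a set) - 1) * \<Prod>(UNIV-{0::'a}) = 1 * \<Prod>(UNIV-{0})"
    by (simp add: prod.distrib)
  moreover have "\<Prod>(UNIV-{0::'a}) \<noteq> 0" by simp
  ultimately show ?thesis by (metis mult_right_cancel)
qed

lemma sum_power_card_minus_1:
  "(\<Sum>x\<in>UNIV. x ^ (card (UNIV :: 'a set) - 1)) = (-1 :: 'a::{field,finite})"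
proof -
  let ?q = "card (UNIV :: 'a set)"
  have q: "1 < ?q" by (rule one_less_card_UNIV)
  have "(\<Sum>x\<in>UNIV. x ^ (?q - 1)) = (\<Sum>x\<in>UNIV - {0::'a}. x ^ (?q - 1))"
    using q by (intro sum.mono_neutral_right) auto
  also have "\<dots> = (\<Sum>x\<in>UNIV - {0::'a}. 1)"
    by (intro sum.cong refl) (simp add: power_card_minus_1_eq_1 del: One_nat_def)
  also have "\<dots> = of_nat (?q - 1)" by simp
  also have "\<dots> = -1" using q by (simp add: of_nat_diff of_nat_card_UNIV_eq_0)
  finally show ?thesis .
qed

text \<open>The polynomial \<open>x ^ j - 1\<close> has at most \<open>j\<close> roots, fewer than
  there are nonzero elements, so some nonzero \<open>g\<close> has \<open>g ^ j\<close> different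
  from 1. Scaling the summation variable by \<open>g\<close> multiplies the sum by
  \<open>g ^ j\<close> and also leaves it unchanged.\<close>

lemma sum_power_eq_0:
  assumes "0 < j" "j < card (UNIV :: 'a set) - 1"
  shows "(\<Sum>x\<in>UNIV. x ^ j) = (0 :: 'a::{field,finite})"
proof -
  define p :: "'a poly" where "p = monom 1 j - 1"
  have "coeff p j = 1" using assms by (simp add: p_def)
  then have "p \<noteq> 0" by auto
  have "degree p \<le> j" unfolding p_def by (rule degree_diff_le) (simp_all add: degree_monom_le)
  then have "card {x. poly p x = 0} < card (UNIV - {0::'a})"
    using card_poly_roots_bound[OF \<open>p \<noteq> 0\<close>] assms by simp
  then have "\<not> UNIV - {0::'a} \<subseteq> {x. poly p x = 0}"
    using card_mono[of "{x. poly p x = 0}" "UNIV - {0}"] by force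
  then obtain g :: 'a where "g \<noteq> 0" "poly p g \<noteq> 0" by auto
  then have g: "g \<noteq> 0" "g ^ j \<noteq> 1" by (auto simp: p_def poly_monom)
  have "(\<Sum>x\<in>UNIV. (g * x) ^ j) = (\<Sum>x\<in>UNIV. x ^ j)"
    by (rule sum_UNIV_inj[of "\<lambda>x. g * x"]) (use g in \<open>auto intro: injI\<close>)
  then have "(g ^ j - 1) * (\<Sum>x\<in>UNIV. x ^ j) = 0"
    by (simp add: power_mult_distrib left_diff_distrib sum_distrib_left sum_subtractf)
  then show ?thesis using g by simp
qed

text \<open>The necessary half of Hermite's criterion for permutation polynomials, stated for
  arbitrary maps so that it applies to rational functions without poles in the field.\<close>

lemma sum_power_inj_eq_0:
  fixes f :: "'a::{field,finite} \<Rightarrow> 'a"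
  assumes "inj f" "0 < j" "j < card (UNIV :: 'a set) - 1"
  shows "(\<Sum>x\<in>UNIV. f x ^ j) = 0"
  using sum_UNIV_inj[OF assms(1), of "\<lambda>x. x ^ j"] sum_power_eq_0[OF assms(2,3)] by simp

text \<open>Up to the exponent q - 1, where q is the order of the field, only the monomial of that
  exponent has a nonzero power sum. The constant term contributes q times itself, which is
  0.\<close>

lemma sum_poly_UNIV:
  fixes p :: "'a::{field,finite} poly"
  assumes "degree p \<le> card (UNIV :: 'a set) - 1"
  shows "(\<Sum>x\<in>UNIV. poly p x) = - coeff p (card (UNIV :: 'a set) - 1)"
proof -
  let ?q = "card (UNIV :: 'a set)"
  have q: "1 < ?q" by (rule one_less_card_UNIV)
  have s: "(\<Sum>x\<in>UNIV. x ^ i) = (if i = ?q - 1 then -1 else 0 :: 'a)" if "i \<le> ?q - 1" for i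
  proof (cases "i = 0")
    case True
    then show ?thesis using q by (simp add: of_nat_card_UNIV_eq_0)
  next
    case False
    then show ?thesis using sum_power_eq_0[of i, where 'a = 'a] that
      by (auto simp: sum_power_card_minus_1 simp del: One_nat_def)
  qed
  have "(\<Sum>x\<in>UNIV. poly p x) = (\<Sum>x\<in>UNIV. \<Sum>i\<le>?q - 1. coeff p i * x ^ i)"
    by (subst (1) poly_as_sum_of_monoms'[OF assms, symmetric]) (simp add: poly_sum poly_monom)
  also have "\<dots> = (\<Sum>i\<le>?q - 1. \<Sum>x\<in>UNIV. coeff p i * x ^ i)" by (rule sum.swap)
  also have "\<dots> = (\<Sum>i\<le>?q - 1. if i = ?q - 1 then - coeff p i else 0)"
    by (intro sum.cong refl) (simp add: s flip: sum_distrib_left)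
  also have "\<dots> = - coeff p (?q - 1)" by simp
  finally show ?thesis .
qed

section \<open>Arithmetic in characteristic 2\<close>

lemma char_two:
  assumes "(2 :: 'a::comm_ring_1) = 0"
  shows "(3 :: 'a) = 1" and "(4 :: 'a) = 0" and "- x = (x :: 'a)"
proof -
  have "(3 :: 'a) = 2 + 1" "(4 :: 'a) = 2 * 2" by simp_all
  then show "(3 :: 'a) = 1" "(4 :: 'a) = 0" by (simp_all only: assms add_0 mult_zero_left)
  have "x + x = 2 * x" by simp
  then show "- x = x" by (simp add: assms add_eq_0_iff)
qed

lemma char_two_square_inj:
  assumes "(2 :: 'a::idom) = 0"
  shows "inj (\<lambda>x::'a. x ^ 2)"
proof (rule injI)
  fix x y :: 'a
  assume "x ^ 2 = y ^ 2"
  then have "x = y \<or> x = - y" by (simp add: power2_eq_iff)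
  moreover have "- y = y" using assms by (rule char_two)
  ultimately show "x = y" by auto
qed

section \<open>Rational functions with a root-free quadratic denominator\<close>

locale rootfree_quadratic =
  fixes t n :: "'a::{field,finite}"
  assumes no_root: "x ^ 2 + t * x + n \<noteq> 0"
begin

definition U where "U x = x ^ 2 + t * x + n"
text \<open>\<open>U'\<close> is the formal derivative of \<open>U\<close>, and \<open>D\<close>
  below is its discriminant.\<close>

definition U' where "U' x = 2 * x + t"
definition D where "D = t ^ 2 - 4 * n"

lemma U_nz [simp]: "U x \<noteq> 0" using no_root by (simp add: U_def)

lemma n_nz [simp]: "n \<noteq> 0" using no_root[of 0] by simp

text \<open>A vanishing discriminant gives a double root inside the field: \<open>- t / 2\<close>
  when 2 is invertible, and in characteristic 2 a square root of \<open>- n\<close>, which exists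
  because squaring is injective on a finite field.\<close>

lemma D_nz [simp]: "D \<noteq> 0"
proof
  assume D: "D = 0"
  show False
  proof (cases "(2::'a) = 0")
    case True
    have "(4::'a) = 2 * 2" by simp
    then have "t = 0" using D True by (simp add: D_def)
    obtain x where "x ^ 2 = - n"
      using finite_UNIV_inj_surj[OF _ char_two_square_inj[OF True]] by (metis finite surj_def)
    then show False using no_root[of x] \<open>t = 0\<close> by simp
  next
    case False
    define s where "s = t / 2"
    have "t = 2 * s" using False by (simp add: s_def)
    have "2 * (2 * U (- s)) = - D"
      unfolding U_def D_def unfolding \<open>t = 2 * s\<close> by (simp add: algebra_simps power2_eq_square)
    then show False using D False by (metis U_nz mult_eq_0_iff neg_equal_0_iff_equal)
  qed
qed

text \<open>If \<open>x \<noteq> y\<close> had the same value, then \<open>(x y + t y + t\<^sup>2 - 3 n) / (x - y)\<close> would be a root of \<open>U\<close>.\<close>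

lemma inj_solution: "inj (\<lambda>x. x + c - D * U' x / U x)"
proof (rule injI, rule ccontr)
  fix x y
  assume eq: "x + c - D * U' x / U x = y + c - D * U' y / U y" and "x \<noteq> y"
  define R where "R = x * y + t * y + t ^ 2 - 3 * n"
  have "(x - y) * (U x * U y) = D * (U' x * U y - U' y * U x)"
  proof -
    have "x - y = D * U' x / U x - D * U' y / U y" using eq by (simp add: algebra_simps)
    then have "(x - y) * (U x * U y) = (D * U' x / U x - D * U' y / U y) * (U x * U y)" by simp
    also have "\<dots> = D * (U' x * U y - U' y * U x)" by (simp add: left_diff_distrib algebra_simps)
    finally show ?thesis .
  qed
  moreover have "(x - y) * (U x * U y) - D * (U' x * U y - U' y * U x) =
      (x - y) * (R ^ 2 + t * R * (x - y) + n * (x - y) ^ 2)"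
    unfolding R_def U_def U'_def D_def by (simp add: algebra_simps power2_eq_square)
  \<comment> \<open>With \<open>k = x - y\<close> the second factor above is \<open>U\<close>
    homogenised, taken at the pair \<open>(R, k)\<close>.\<close>
  moreover have "R ^ 2 + t * R * k + n * k ^ 2 = k ^ 2 * U (R / k)" if "k \<noteq> 0" for k
    using that by (simp add: U_def power_divide field_simps power2_eq_square)
  ultimately have "(x - y) * ((x - y) ^ 2 * U (R / (x - y))) = 0"
    using \<open>x \<noteq> y\<close> by simp
  then show False using \<open>x \<noteq> y\<close> by simp
qed

text \<open>The substitutions \<open>n / x\<close> and \<open>- t - x\<close> both interchange the
  two conjugate roots of \<open>U\<close>, hence multiply \<open>U\<close> by a simple factor:
  \<open>n / x ^ 2\<close> and 1. The first relation comes from \<open>n / x\<close> on the nonzero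
  elements, the second from \<open>- t - x\<close>.\<close>

lemma sum_inverse_relations:
  shows "2 * n * (\<Sum>x\<in>UNIV. 1 / U x) + t * (\<Sum>x\<in>UNIV. x / U x) = 1" (is "2 * n * ?T + t * ?S = 1")
    and "2 * (\<Sum>x\<in>UNIV. x / U x) = - t * (\<Sum>x\<in>UNIV. 1 / U x)"
proof -
  have "U (n / x) = n * U x / x ^ 2" if "x \<noteq> 0" for x
    using that by (simp add: U_def field_simps power2_eq_square)
  then have "x ^ 2 / (n * U x) = 1 / U (n / x)" if "x \<noteq> 0" for x
    using that by simp
  then have "(\<Sum>x\<in>UNIV - {0}. 1 / U x) = (\<Sum>x\<in>UNIV - {0}. x ^ 2 / (n * U x))"
    by (intro sum.reindex_bij_witness[of _ "\<lambda>x. n / x" "\<lambda>x. n / x"]) auto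
  also have "\<dots> = (\<Sum>x\<in>UNIV. x ^ 2 / (n * U x))" by (intro sum.mono_neutral_left) auto
  also have "\<dots> = (\<Sum>x\<in>UNIV. 1 / n - t / n * (x / U x) - 1 / U x)"
    by (intro sum.cong refl) (simp add: field_simps, simp add: U_def algebra_simps power2_eq_square)
  also have "\<dots> = - t / n * ?S - ?T"
    by (simp only: sum_subtractf sum_distrib_left[symmetric]) (simp add: of_nat_card_UNIV_eq_0)
  finally have "?T - 1 / n = - t / n * ?S - ?T"
    by (simp add: sum_diff1 U_def)
  then show "2 * n * ?T + t * ?S = 1" by (simp add: field_simps)
  have "(\<Sum>x\<in>UNIV. (- t - x) / U (- t - x)) = ?S"
    by (rule sum_UNIV_inj[of "\<lambda>x. - t - x"]) (auto intro: injI)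
  moreover have "U (- t - x) = U x" for x by (simp add: U_def algebra_simps power2_eq_square)
  ultimately have "(\<Sum>x\<in>UNIV. (- t - x) / U x) = ?S" by simp
  then show "2 * ?S = - t * ?T"
    by (simp add: diff_divide_distrib sum_subtractf sum_distrib_left sum_negf)
qed

text \<open>Cramer's rule for the two relations, a linear system of determinant \<open>- D\<close>.
  No division by 2 occurs, so characteristic 2 is covered.\<close>

lemma sum_inverse:
  shows "D * (\<Sum>x\<in>UNIV. 1 / U x) = - 2" and "D * (\<Sum>x\<in>UNIV. x / U x) = t"
  using sum_inverse_relations unfolding D_def by algebra+

lemma sum_times_log_deriv: "(\<Sum>x\<in>UNIV. x * (U' x / U x)) = - 1"
proof -
  have "(\<Sum>x\<in>UNIV. x * (U' x / U x)) = (\<Sum>x\<in>UNIV. 2 - t * (x / U x) - 2 * n * (1 / U x))"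
    by (intro sum.cong refl) (simp add: field_simps, simp add: U_def U'_def algebra_simps power2_eq_square)
  also have "\<dots> = - t * (\<Sum>x\<in>UNIV. x / U x) - 2 * n * (\<Sum>x\<in>UNIV. 1 / U x)"
    by (simp only: sum_subtractf sum_distrib_left[symmetric]) (simp add: of_nat_card_UNIV_eq_0)
  also have "\<dots> = - 1" using sum_inverse_relations(1) by algebra
  finally show ?thesis .
qed

text \<open>Expanding the second power sum, the square of \<open>x\<close> contributes 0 and the
  mixed term is known, so one factor \<gamma> can be cancelled. The exponent 2 has to stay below q -
  1, whence the bound on the field.\<close>

lemma sum_log_deriv_quadratic:
  assumes inj: "inj (\<lambda>x. x + \<gamma> * (U' x / U x))" and q: "3 < card (UNIV :: 'a set)" and "\<gamma> \<noteq> 0"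
  shows "2 = \<gamma> * (\<Sum>x\<in>UNIV. (U' x / U x) ^ 2)"
proof -
  have "0 = (\<Sum>x\<in>UNIV. (x + \<gamma> * (U' x / U x)) ^ 2)" using sum_power_inj_eq_0[OF inj] q by simp
  also have "\<dots> = (\<Sum>x\<in>UNIV. x ^ 2 + 2 * \<gamma> * (x * (U' x / U x)) + \<gamma> ^ 2 * (U' x / U x) ^ 2)"
    by (intro sum.cong refl) algebra
  also have "\<dots> = - 2 * \<gamma> + \<gamma> ^ 2 * (\<Sum>x\<in>UNIV. (U' x / U x) ^ 2)"
    using q sum_power_eq_0[of 2, where 'a = 'a]
    by (simp only: sum.distrib sum_distrib_left[symmetric] sum_times_log_deriv) simp
  finally have "\<gamma> * (- 2 + \<gamma> * (\<Sum>x\<in>UNIV. (U' x / U x) ^ 2)) = 0" by algebra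
  then show ?thesis using \<open>\<gamma> \<noteq> 0\<close> by simp
qed

text \<open>In characteristic 2 the second power sum is the square of the first and says nothing new,
  so the third is used. There \<open>U' / U\<close> is invariant under \<open>x \<mapsto> x + t\<close>, which makes the power sums
  of \<open>U' / U\<close> vanish.\<close>

lemma sum_log_deriv_cubic:
  assumes inj: "inj (\<lambda>x. x + \<gamma> * (U' x / U x))" and q: "4 < card (UNIV :: 'a set)" and "\<gamma> \<noteq> 0"
    and char: "(2::'a) = 0"
  shows "(\<Sum>x\<in>UNIV. x ^ 2 * (U' x / U x)) + \<gamma> * (\<Sum>x\<in>UNIV. x * (U' x / U x) ^ 2) = 0"
proof -
  have four: "(4::'a) = 0" using char by (rule char_two)
  have "t \<noteq> 0" using D_nz four by (auto simp: D_def)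
  have U': "U' x = t" for x by (simp add: U'_def char)
  have three: "(3::'a) = 1" using char by (rule char_two)
  have "U (x + t) = U x + 2 * (t * x + t * t)" for x
    by (simp add: U_def algebra_simps power2_eq_square)
  then have Ut: "U (x + t) = U x" for x by (simp add: char)
  \<comment> \<open>The weight \<open>x\<close> is what makes the shift informative: it changes by
    \<open>t\<close> while \<open>U' / U\<close> is fixed, so the difference of the two sides is
    \<open>t\<close> times the sum of cubes.\<close>
  have "(\<Sum>x\<in>UNIV. (x + t) * (U' (x + t) / U (x + t)) ^ 3) = (\<Sum>x\<in>UNIV. x * (U' x / U x) ^ 3)"
    by (rule sum_UNIV_inj[of "\<lambda>x. x + t"]) (auto intro: injI)
  then have "t * (\<Sum>x\<in>UNIV. (U' x / U x) ^ 3) = 0"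
    by (simp add: Ut U' distrib_right sum.distrib sum_distrib_left)
  then have cube: "(\<Sum>x\<in>UNIV. (U' x / U x) ^ 3) = 0" using \<open>t \<noteq> 0\<close> by simp
  have "0 = (\<Sum>x\<in>UNIV. (x + \<gamma> * (U' x / U x)) ^ 3)" using sum_power_inj_eq_0[OF inj] q by simp
  also have "\<dots> = (\<Sum>x\<in>UNIV. x ^ 3 + 3 * \<gamma> * (x ^ 2 * (U' x / U x))
      + 3 * \<gamma> ^ 2 * (x * (U' x / U x) ^ 2) + \<gamma> ^ 3 * (U' x / U x) ^ 3)"
    by (intro sum.cong refl) algebra
  also have "\<dots> = \<gamma> * (\<Sum>x\<in>UNIV. x ^ 2 * (U' x / U x)) + \<gamma> ^ 2 * (\<Sum>x\<in>UNIV. x * (U' x / U x) ^ 2)"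
    using q sum_power_eq_0[of 3, where 'a = 'a]
    by (simp only: sum.distrib sum_distrib_left[symmetric] cube three) simp
  finally have "\<gamma> * ((\<Sum>x\<in>UNIV. x ^ 2 * (U' x / U x)) + \<gamma> * (\<Sum>x\<in>UNIV. x * (U' x / U x) ^ 2)) = 0"
    by algebra
  then show ?thesis using \<open>\<gamma> \<noteq> 0\<close> by simp
qed

lemma inj_solution_unique:
  assumes inj: "inj (\<lambda>x. x + c + (\<alpha> * x + \<beta>) / U x)" and q: "4 < card (UNIV :: 'a set)"
    and nz: "(\<alpha>, \<beta>) \<noteq> (0, 0)"
  shows "\<alpha> = - 2 * D \<and> \<beta> = - D * t"
proof -
  have inj0: "inj (\<lambda>x. x + (\<alpha> * x + \<beta>) / U x)"
  proof (rule injI)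
    fix x y assume "x + (\<alpha> * x + \<beta>) / U x = y + (\<alpha> * y + \<beta>) / U y"
    then have "x + c + (\<alpha> * x + \<beta>) / U x = y + c + (\<alpha> * y + \<beta>) / U y"
      by (simp only: add.assoc add.left_commute[of _ c])
    then show "x = y" by (rule injD[OF inj])
  qed
  have "0 = (\<Sum>x\<in>UNIV. (x + (\<alpha> * x + \<beta>) / U x) ^ 1)" using sum_power_inj_eq_0[OF inj0, of 1] q by simp
  also have "\<dots> = (\<Sum>x\<in>UNIV. x ^ 1 + \<alpha> * (x / U x) + \<beta> * (1 / U x))"
    by (intro sum.cong refl) (simp add: field_simps)
  also have "\<dots> = \<alpha> * (\<Sum>x\<in>UNIV. x / U x) + \<beta> * (\<Sum>x\<in>UNIV. 1 / U x)"
    using q sum_power_eq_0[of 1, where 'a = 'a]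
    by (simp only: sum.distrib sum_distrib_left[symmetric]) simp
  finally have ab: "\<alpha> * t = 2 * \<beta>" using sum_inverse by algebra
  \<comment> \<open>In characteristic 2 the relation \<open>ab\<close> reads \<alpha> = 0, since
    \<open>t\<close> is nonzero there, and \<gamma> is recovered from \<beta>; otherwise it is half
    of \<alpha>.\<close>
  obtain \<gamma> where \<gamma>: "\<alpha> = 2 * \<gamma>" "\<beta> = \<gamma> * t"
  proof (cases "(2::'a) = 0")
    case True
    then have "(4::'a) = 0" by (rule char_two)
    then have "t \<noteq> 0" using D_nz by (auto simp: D_def)
    then show ?thesis using that[of "\<beta> / t"] ab True by simp
  next
    case False
    then show ?thesis using that[of "\<alpha> / 2"] ab by (simp add: field_simps)
  qed
  have \<gamma>nz: "\<gamma> \<noteq> 0" using nz \<gamma> by auto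
  have "\<alpha> * x + \<beta> = \<gamma> * U' x" for x by (simp add: \<gamma> U'_def algebra_simps)
  then have inj1: "inj (\<lambda>x. x + \<gamma> * (U' x / U x))" using inj0 by simp
  have inj2: "inj (\<lambda>x. x + (- D) * (U' x / U x))" using inj_solution[of 0] by simp
  have "\<gamma> = - D"
  proof (cases "(2::'a) = 0")
    case False
    have q': "3 < card (UNIV :: 'a set)" using q by simp
    \<comment> \<open>\<open>Q\<close> is the same for \<gamma> and for the known solution
      \<open>- D\<close>. Both products with \<open>Q\<close> equal 2, so \<open>Q\<close> is
      nonzero and can be cancelled.\<close>
    define Q where "Q = (\<Sum>x\<in>UNIV. (U' x / U x) ^ 2)"
    have "2 = \<gamma> * Q" unfolding Q_def by (rule sum_log_deriv_quadratic[OF inj1 q' \<gamma>nz])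
    moreover have "2 = (- D) * Q" unfolding Q_def by (rule sum_log_deriv_quadratic[OF inj2 q']) simp
    ultimately have "\<gamma> * Q = (- D) * Q" "Q \<noteq> 0" using False by auto
    then show ?thesis by (blast dest: mult_right_cancel[THEN iffD1])
  next
    case True
    \<comment> \<open>The value is \<open>- t\<close>: in characteristic 2 the sum of
      \<open>1 / U\<close> vanishes and \<open>D = t ^ 2\<close>. This keeps the linear equation for
      \<gamma> from degenerating.\<close>
    have sq: "(\<Sum>x\<in>UNIV. x ^ 2 * (U' x / U x)) \<noteq> 0"
    proof -
      have U': "U' x = t" for x by (simp add: U'_def True)
      have "(\<Sum>x\<in>UNIV. x ^ 2 * (U' x / U x)) = (\<Sum>x\<in>UNIV. t - t ^ 2 * (x / U x) - t * n * (1 / U x))"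
        by (intro sum.cong refl) (simp add: field_simps U', simp add: U_def algebra_simps power2_eq_square)
      also have "\<dots> = - (t ^ 2) * (\<Sum>x\<in>UNIV. x / U x) - t * n * (\<Sum>x\<in>UNIV. 1 / U x)"
        by (simp only: sum_subtractf sum_distrib_left[symmetric]) (simp add: of_nat_card_UNIV_eq_0)
      finally have e: "(\<Sum>x\<in>UNIV. x ^ 2 * (U' x / U x)) =
        - (t ^ 2) * (\<Sum>x\<in>UNIV. x / U x) - t * n * (\<Sum>x\<in>UNIV. 1 / U x)" .
      have f: "(4::'a) = 0" using True by (rule char_two)
      then have "t \<noteq> 0" "D = t ^ 2" using D_nz by (auto simp: D_def)
      then have "(\<Sum>x\<in>UNIV. 1 / U x) = 0" "(\<Sum>x\<in>UNIV. x / U x) * t ^ 2 = t" 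
        using sum_inverse True by (auto simp: mult.commute)
      with e show ?thesis using \<open>t \<noteq> 0\<close> by (simp add: mult.commute)
    qed
    define P where "P = (\<Sum>x\<in>UNIV. x ^ 2 * (U' x / U x))"
    define Q where "Q = (\<Sum>x\<in>UNIV. x * (U' x / U x) ^ 2)"
    have "P + \<gamma> * Q = 0" unfolding P_def Q_def by (rule sum_log_deriv_cubic[OF inj1 q \<gamma>nz True])
    moreover have "P + (- D) * Q = 0"
      unfolding P_def Q_def by (rule sum_log_deriv_cubic[OF inj2 q _ True]) simp
    moreover have "P \<noteq> 0" unfolding P_def by (rule sq)
    ultimately have "\<gamma> * Q = (- D) * Q" "Q \<noteq> 0" by (simp_all only: add_eq_0_iff) auto
    then show ?thesis by (blast dest: mult_right_cancel[THEN iffD1])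
  qed
  then show ?thesis by (simp add: \<gamma>)
qed

end

section \<open>Permutation arrays from permutation rational functions\<close>

lemma card_le_M:
  fixes F :: "('b::finite \<Rightarrow> 'b) set"
  assumes card: "card (UNIV :: 'b set) = n"
    and bij: "\<And>f. f \<in> F \<Longrightarrow> bij f"
    and dist: "\<And>f g. f \<in> F \<Longrightarrow> g \<in> F \<Longrightarrow> f \<noteq> g \<Longrightarrow> d \<le> card {x. f x \<noteq> g x}"
  shows "card F \<le> M n d"
proof -
  obtain e :: "'b \<Rightarrow> nat" where e: "bij_betw e UNIV {..<n}"
    using ex_bij_betw_finite_nat[of "UNIV :: 'b set"] card by (auto simp: atLeast0LessThan)
  \<comment> \<open>Conjugation by the numbering \<open>e\<close> preserves the number of
    disagreements; \<open>permutes\<close> demands the identity outside the range of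
    \<open>e\<close>.\<close>
  define P where "P f i = (if i < n then e (f (inv e i)) else i)" for f :: "'b \<Rightarrow> 'b" and i
  have inj: "inj e" and range: "e x < n" and inv: "inv e (e x) = x" for x
    using e by (auto simp: bij_betw_def)
  have P: "P f (e x) = e (f x)" for f x by (simp add: P_def range inv)
  have perm: "P f permutes {..<n}" if "f \<in> F" for f
  proof (rule bij_imp_permutes)
    have "bij_betw (\<lambda>i. e (f (inv e i))) {..<n} {..<n}"
      using bij_betw_trans[OF bij_betw_trans[OF bij_betw_inv_into[OF e] bij[OF that]] e]
      by (simp add: o_def)
    then show "bij_betw (P f) {..<n} {..<n}"
      by (rule bij_betw_cong[THEN iffD1, rotated]) (simp add: P_def)
  qed (simp add: P_def)
  have hd: "hamming_dist n (P f) (P g) = card {x. f x \<noteq> g x}" for f g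
  proof -
    have "{i \<in> {..<n}. P f i \<noteq> P g i} = {i \<in> range e. P f i \<noteq> P g i}"
      using e by (simp add: bij_betw_def)
    also have "\<dots> = e ` {x. f x \<noteq> g x}" by (auto simp: P inj_eq[OF inj])
    finally have "{i \<in> {..<n}. P f i \<noteq> P g i} = e ` {x. f x \<noteq> g x}" .
    then show ?thesis
      unfolding hamming_dist_def by (simp add: card_image inj_on_subset[OF inj])
  qed
  have "inj_on P F"
  proof (rule inj_onI, rule ext)
    fix f g x assume "P f = P g"
    then have "e (f x) = e (g x)" by (metis P)
    then show "f x = g x" by (simp add: inj_eq[OF inj])
  qed
  then have "card F = card (P ` F)" by (simp add: card_image)
  moreover have "permutation_array n d (P ` F)"
    unfolding permutation_array_def using perm dist by (auto simp: hd)
  moreover have "finite {card A |A. permutation_array n d A}"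
  proof (rule finite_subset)
    show "{card A |A. permutation_array n d A} \<subseteq> card ` Pow {p. p permutes {..<n}}"
      by (auto simp: permutation_array_def)
    show "finite (card ` Pow {p. p permutes {..<n}})" by (simp add: finite_permutations)
  qed
  ultimately show ?thesis unfolding M_def by (intro Max_ge) auto
qed

section \<open>Reduced fractions with monic denominator\<close>

lemma coprime_bezout_poly:
  fixes a b :: "'a::field poly"
  assumes "coprime a b"
  shows "\<exists>r s. r * a + s * b = 1"
  using assms
\<comment> \<open>The Euclidean algorithm. The successor separates the zero polynomial from the
  nonzero constants, which have the same degree 0.\<close>
proof (induction "if b = 0 then 0 else Suc (degree b)" arbitrary: a b rule: less_induct)
  case less
  show ?case
  proof (cases "b = 0")
    case True
    then have "is_unit a" using less.prems by simp
    then obtain r where "1 = a * r" by (auto elim: dvdE)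
    then show ?thesis by (metis True add_0_right mult.commute mult_zero_right)
  next
    case False
    have "coprime b (a mod b)"
      using less.prems by (auto simp: coprime_def dvd_mod_iff)
    moreover have "(if a mod b = 0 then 0 else Suc (degree (a mod b))) < Suc (degree b)"
      using degree_mod_less[OF False, of a] by auto
    ultimately obtain r s where "r * b + s * (a mod b) = 1"
      using less.hyps[of "a mod b" b] False by auto
    then have "s * a + (r - s * (a div b)) * b = 1"
      by (simp add: algebra_simps minus_div_mult_eq_mod[symmetric])
    then show ?thesis by blast
  qed
qed

lemma coprime_dvd_mult_poly:
  fixes a b c :: "'a::field poly"
  assumes "coprime a b" "b dvd a * c"
  shows "b dvd c"
proof -
  obtain r s where rs: "r * a + s * b = 1" using coprime_bezout_poly[OF assms(1)] by blast
  have "c = (r * a + s * b) * c" by (simp add: rs)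
  also have "\<dots> = r * (a * c) + b * (s * c)" by (simp add: algebra_simps)
  finally show ?thesis using assms(2) by (metis dvd_add dvd_mult dvd_triv_left)
qed

lemma monic_dvd_antisym:
  fixes p q :: "'a::field poly"
  assumes "p dvd q" "q dvd p" "lead_coeff p = 1" "lead_coeff q = 1"
  shows "p = q"
proof -
  obtain c where c: "q = p * c" using assms(1) by (rule dvdE)
  have "p \<noteq> 0" "q \<noteq> 0" using assms(3,4) by auto
  then have "degree q = degree p"
    using dvd_imp_degree_le[OF assms(1)] dvd_imp_degree_le[OF assms(2)] by simp
  moreover have "c \<noteq> 0" using c \<open>q \<noteq> 0\<close> by auto
  ultimately have "degree c = 0" using c \<open>p \<noteq> 0\<close> by (simp add: degree_mult_eq)
  then obtain k where k: "c = [:k:]" by (rule degree_eq_zeroE)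
  then have "q = smult k p" using c by simp
  then have "k = 1" using assms(3,4) by (cases "k = 0") auto
  then show ?thesis using \<open>q = smult k p\<close> by simp
qed

lemma cross_mult_eq_imp_eq:
  fixes V U V' U' :: "'a::field poly"
  assumes "coprime V U" "coprime V' U'" "lead_coeff U = 1" "lead_coeff U' = 1" "V * U' = V' * U"
  shows "V = V' \<and> U = U'"
proof -
  have "U dvd V * U'" "U' dvd V' * U" using assms(5) by (simp, metis dvd_triv_right)
  then have "U dvd U'" "U' dvd U" using coprime_dvd_mult_poly assms(1,2) by blast+
  then have "U = U'" using assms(3,4) by (rule monic_dvd_antisym)
  moreover have "U \<noteq> 0" using assms(3) by auto
  ultimately show ?thesis using assms(5) by auto
qed

text \<open>Scaling the denominator to be monic leaves exactly one reduced pair for each element of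
  the fraction field, so all counting can be done with pairs of polynomials.\<close>

definition PRF_pairs :: "nat \<Rightarrow> nat \<Rightarrow> ('a::field poly \<times> 'a poly) set" where
  "PRF_pairs v u = {(V, U). is_PRF V U \<and> degree V = v \<and> degree U = u \<and> lead_coeff U = 1}"

lemma is_PRF_smult:
  assumes "is_PRF V U" "k \<noteq> 0"
  shows "is_PRF (smult k V) (smult k U)"
proof -
  have "ratfun_eval (smult k V) (smult k U) = ratfun_eval V U"
    using assms(2) by (auto simp: ratfun_eval_def fun_eq_iff split: option.split)
  then show ?thesis
    using assms by (auto simp: is_PRF_def coprime_def dvd_smult_iff)
qed

lemma inj_on_Fract_PRF_pairs: "inj_on (\<lambda>(V, U). Fract V U) (PRF_pairs v u)"
  by (rule inj_onI) (auto simp: PRF_pairs_def is_PRF_def eq_fract dest: cross_mult_eq_imp_eq)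

lemma PRF_eq_image: "PRF v u = (\<lambda>(V, U). Fract V U) ` PRF_pairs v u"
proof safe
  fix x :: "'a poly fract" assume "x \<in> PRF v u"
  then obtain V U where VU: "x = Fract V U" "is_PRF V U" "degree V = v" "degree U = u"
    by (auto simp: PRF_def)
  define k where "k = inverse (lead_coeff U)"
  have U: "U \<noteq> 0" using VU by (auto simp: is_PRF_def)
  then have k: "k \<noteq> 0" "k * lead_coeff U = 1" by (auto simp: k_def)
  have "(smult k V, smult k U) \<in> PRF_pairs v u"
    using VU k by (auto simp: PRF_pairs_def is_PRF_smult)
  moreover have "x = Fract (smult k V) (smult k U)"
    using VU U k by (simp add: eq_fract)
  ultimately show "x \<in> (\<lambda>(V, U). Fract V U) ` PRF_pairs v u" by (intro image_eqI[of _ _ "(smult k V, smult k U)"]) simp_all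
qed (auto simp: PRF_def PRF_pairs_def)

lemma N_eq_card: "N TYPE('a::field) v u = card (PRF_pairs v u :: ('a poly \<times> 'a poly) set)"
  unfolding N_def PRF_eq_image by (rule card_image[OF inj_on_Fract_PRF_pairs])

definition monic_PRF_pairs :: "nat \<Rightarrow> nat \<Rightarrow> ('a::field poly \<times> 'a poly) set" where
  "monic_PRF_pairs v u = {(V, U) \<in> PRF_pairs v u. lead_coeff V = 1}"

lemma N_monic_eq_card:
  "N_monic TYPE('a::field) v u = card (monic_PRF_pairs v u :: ('a poly \<times> 'a poly) set)"
proof -
  have "(monic_PRF v u :: 'a poly fract set) = (\<lambda>(V, U). Fract V U) ` monic_PRF_pairs v u"
    by (force simp: monic_PRF_def monic_PRF_pairs_def PRF_pairs_def)
  moreover have "inj_on (\<lambda>(V, U). Fract V U) (monic_PRF_pairs v u :: ('a poly \<times> 'a poly) set)"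
    by (rule inj_on_subset[OF inj_on_Fract_PRF_pairs]) (auto simp: monic_PRF_pairs_def)
  ultimately show ?thesis by (simp add: N_monic_def card_image)
qed

section \<open>Points of agreement of two rational functions\<close>

lemma card_agreement_le:
  fixes V U V' U' :: "'a::{field,finite} poly"
  assumes "V * U' - V' * U \<noteq> 0"
  shows "card {x. ratfun_eval V U x = ratfun_eval V' U' x} \<le> degree (V * U' - V' * U)
    + (if ratfun_eval V U None = ratfun_eval V' U' None then 1 else 0)"
proof -
  let ?W = "V * U' - V' * U"
  let ?I = "if ratfun_eval V U None = ratfun_eval V' U' None then {None} else ({} :: 'a option set)"
  \<comment> \<open>Common poles are covered as well: there both denominators vanish, and with them
    both products in \<open>?W\<close>. Infinity is not seen by \<open>?W\<close> and is counted
    separately.\<close>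
  have "{x. ratfun_eval V U x = ratfun_eval V' U' x} \<subseteq> Some ` {a. poly ?W a = 0} \<union> ?I"
  proof
    fix x assume x: "x \<in> {x. ratfun_eval V U x = ratfun_eval V' U' x}"
    show "x \<in> Some ` {a. poly ?W a = 0} \<union> ?I"
    proof (cases x)
      case (Some a)
      then have "poly ?W a = 0"
        using x by (auto simp: ratfun_eval_def field_simps split: if_splits)
      then show ?thesis using Some by auto
    qed (use x in auto)
  qed
  then have "card {x. ratfun_eval V U x = ratfun_eval V' U' x} \<le> card (Some ` {a. poly ?W a = 0} \<union> ?I)"
    by (intro card_mono) auto
  also have "\<dots> \<le> card (Some ` {a. poly ?W a = 0}) + card ?I" by (rule card_Un_le)
  also have "card (Some ` {a. poly ?W a = 0}) \<le> degree ?W"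
    using card_poly_roots_bound[OF assms] by (simp add: card_image)
  finally show ?thesis by (auto split: if_splits)
qed

lemma ratfun_eval_None_eq_None: "ratfun_eval V U None = None \<longleftrightarrow> degree U < degree V"
  by (auto simp: ratfun_eval_def)

definition small_PRF_pairs :: "('a::field poly \<times> 'a poly) set" where
  "small_PRF_pairs = (\<Union>(v, u)\<in>{0..2} \<times> {0..2}. PRF_pairs v u)"

lemma agreement_small_small:
  fixes V :: "'a::{field,finite} poly"
  assumes "(V, U) \<in> small_PRF_pairs" "(V', U') \<in> small_PRF_pairs" "V * U' - V' * U \<noteq> 0"
  shows "card {x. ratfun_eval V U x = ratfun_eval V' U' x} \<le> 5"
proof -
  have "degree V \<le> 2" "degree U \<le> 2" "degree V' \<le> 2" "degree U' \<le> 2"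
    using assms(1,2) by (auto simp: small_PRF_pairs_def PRF_pairs_def)
  then have "degree (V * U' - V' * U) \<le> 4"
    by (intro degree_diff_le order.trans[OF degree_mult_le]) auto
  then show ?thesis using card_agreement_le[OF assms(3)] by (auto split: if_splits)
qed

lemma agreement_small_cubic:
  fixes V :: "'a::{field,finite} poly"
  assumes "(V, U) \<in> small_PRF_pairs" "degree V' = 3" "degree U' \<le> 2" "V * U' - V' * U \<noteq> 0"
  shows "card {x. ratfun_eval V U x = ratfun_eval V' U' x} \<le> 5"
proof -
  have d: "degree V \<le> 2" "degree U \<le> 2"
    using assms(1) by (auto simp: small_PRF_pairs_def PRF_pairs_def)
  have inf: "ratfun_eval V' U' None = None" using assms(2,3) by (simp add: ratfun_eval_None_eq_None)
  \<comment> \<open>Agreement at infinity means that \<open>V / U\<close> has a pole there, so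
    \<open>U\<close> is at most linear. The degree bound then drops from 5 to 4, which leaves room
    for the point at infinity.\<close>
  have "degree U \<le> 1" if "ratfun_eval V U None = ratfun_eval V' U' None"
    using ratfun_eval_None_eq_None[of V U] that inf d by simp
  moreover have "degree (V * U' - V' * U) \<le> 3 + max 1 (degree U)"
    using assms(2,3) d by (intro degree_diff_le order.trans[OF degree_mult_le]) auto
  ultimately show ?thesis
    using card_agreement_le[OF assms(4)] d by (auto split: if_splits)
qed

lemma agreement_monic_cubic:
  fixes V :: "'a::{field,finite} poly"
  assumes "(V, U) \<in> monic_PRF_pairs 3 2" "(V', U') \<in> monic_PRF_pairs 3 2" "V * U' - V' * U \<noteq> 0"
  shows "card {x. ratfun_eval V U x = ratfun_eval V' U' x} \<le> 5"
proof -
  have d: "degree V = 3" "degree U = 2" "degree V' = 3" "degree U' = 2"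
    and l: "lead_coeff V = 1" "lead_coeff U = 1" "lead_coeff V' = 1" "lead_coeff U' = 1"
    using assms(1,2) by (auto simp: monic_PRF_pairs_def PRF_pairs_def)
  have le: "degree (V * U' - V' * U) \<le> 5"
    using d by (intro degree_diff_le order.trans[OF degree_mult_le]) auto
  \<comment> \<open>Both functions map infinity to itself, which already costs one agreement, so the
    degree must drop to 4.\<close>
  have "coeff (V * U') (degree V + degree U') = 1" "coeff (V' * U) (degree V' + degree U) = 1"
    by (simp_all add: coeff_mult_degree_sum l)
  then have "coeff (V * U' - V' * U) 5 = 0" by (simp add: d)
  then have "degree (V * U' - V' * U) \<noteq> 5" using assms(3) by (metis leading_coeff_0_iff)
  with le show ?thesis using card_agreement_le[OF assms(3)] by (auto split: if_splits)
qed

lemma agreement_cubic_poly: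
  fixes V :: "'a::{field,finite} poly"
  assumes "(V, U) \<in> PRF_pairs 3 0" "(V', U') \<in> PRF_pairs 3 0" "V * U' - V' * U \<noteq> 0"
  shows "card {x. ratfun_eval V U x = ratfun_eval V' U' x} \<le> 5"
proof -
  have "degree (V * U' - V' * U) \<le> 3"
    using assms(1,2) by (intro degree_diff_le order.trans[OF degree_mult_le]) (auto simp: PRF_pairs_def)
  then show ?thesis using card_agreement_le[OF assms(3)] by (auto split: if_splits)
qed

lemma finite_poly_pairs:
  assumes "\<And>V U. (V, U) \<in> (S :: ('a::{field,finite} poly \<times> 'a poly) set) \<Longrightarrow> degree V \<le> k \<and> degree U \<le> k"
  shows "finite S"
proof -
  let ?f = "\<lambda>xs :: 'a list. Poly xs"
  have "finite (Poly ` {xs :: 'a list. length xs \<le> Suc k})"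
    using finite_lists_length_le[of "UNIV :: 'a set" "Suc k"] by simp
  moreover have "p \<in> Poly ` {xs :: 'a list. length xs \<le> Suc k}" if "degree p \<le> k" for p :: "'a poly"
    using that by (intro image_eqI[of _ _ "coeffs p"], simp)
      (cases "p = 0", auto simp: length_coeffs_degree)
  ultimately have "finite {p :: 'a poly. degree p \<le> k}" by (auto intro: finite_subset[rotated])
  moreover have "S \<subseteq> {p. degree p \<le> k} \<times> {p. degree p \<le> k}" using assms by auto
  ultimately show ?thesis by (auto intro: finite_subset)
qed

lemma T3_eq_card: "T3 TYPE('a::{field,finite}) = card (small_PRF_pairs :: ('a poly \<times> 'a poly) set)"
proof -
  have "card (small_PRF_pairs :: ('a poly \<times> 'a poly) set)
      = (\<Sum>p\<in>{0..2} \<times> {0..2}. card ((\<lambda>(v, u). PRF_pairs v u) p :: ('a poly \<times> 'a poly) set))"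
    unfolding small_PRF_pairs_def
    by (rule card_UN_disjoint)
      (auto intro!: finite_poly_pairs[of _ 2] simp: PRF_pairs_def)
  then show ?thesis by (simp add: T3_def N_eq_card split_beta)
qed

text \<open>The two families enter as alternatives because the estimate fails between them: a cubic
  polynomial and a function of type (3, 2) agree at infinity, and their cross difference has degree
  5, which allows six agreements.\<close>

lemma card_union_small_le_M:
  fixes S :: "('a::{field,finite} poly \<times> 'a poly) set"
  assumes S: "S = monic_PRF_pairs 3 2 \<or> S = PRF_pairs 3 0"
    and q: "5 < card (UNIV :: 'a set)"
  shows "T3 TYPE('a) + card S \<le> M (card (UNIV :: 'a set) + 1) (card (UNIV :: 'a set) - 4)"
proof -
  define K where "K = small_PRF_pairs \<union> S"
  let ?ev = "\<lambda>(V, U). ratfun_eval V U :: 'a option \<Rightarrow> 'a option"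
  have S': "degree V = 3 \<and> degree U \<le> 2 \<and> is_PRF V U \<and> lead_coeff U = 1" if "(V, U) \<in> S" for V U
    using S that by (auto simp: monic_PRF_pairs_def PRF_pairs_def)
  have small: "degree V \<le> 2 \<and> degree U \<le> 2 \<and> is_PRF V U \<and> lead_coeff U = 1"
    if "(V, U) \<in> small_PRF_pairs" for V U :: "'a poly"
    using that by (auto simp: small_PRF_pairs_def PRF_pairs_def)
  have K: "is_PRF V U" "lead_coeff U = 1" if "(V, U) \<in> K" for V U
    using that S' small by (auto simp: K_def)
  have card_K: "card K = T3 TYPE('a) + card S" unfolding K_def T3_eq_card
  proof (rule card_Un_disjoint)
    show "finite (small_PRF_pairs :: ('a poly \<times> 'a poly) set)" "finite S"
      using S' small by (force intro!: finite_poly_pairs[of _ 3])+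
    show "small_PRF_pairs \<inter> S = {}" using S' small by fastforce
  qed
  have agree: "card {x. ?ev p x = ?ev p' x} \<le> 5" if "p \<in> K" "p' \<in> K" "p \<noteq> p'" for p p'
  proof -
    obtain V U V' U' where p: "p = (V, U)" "p' = (V', U')" by (cases p, cases p')
    have W: "V * U' - V' * U \<noteq> 0"
      using cross_mult_eq_imp_eq[of V U V' U'] K that by (auto simp: p is_PRF_def)
    then have W': "V' * U - V * U' \<noteq> 0" by auto
    show ?thesis
    proof (cases "p \<in> small_PRF_pairs"; cases "p' \<in> small_PRF_pairs")
      assume "p \<in> small_PRF_pairs" "p' \<in> small_PRF_pairs"
      then show ?thesis using agreement_small_small[OF _ _ W] by (simp add: p)
    next
      assume "p \<in> small_PRF_pairs" "p' \<notin> small_PRF_pairs"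
      then have "(V, U) \<in> small_PRF_pairs" "(V', U') \<in> S" using that by (auto simp: p K_def)
      then have "card {x. ratfun_eval V U x = ratfun_eval V' U' x} \<le> 5"
        using S'[of V' U'] W by (intro agreement_small_cubic) simp_all
      then show ?thesis by (simp add: p)
    next
      assume "p \<notin> small_PRF_pairs" "p' \<in> small_PRF_pairs"
      then have "(V', U') \<in> small_PRF_pairs" "(V, U) \<in> S" using that by (auto simp: p K_def)
      then have "card {x. ratfun_eval V' U' x = ratfun_eval V U x} \<le> 5"
        using S'[of V U] W' by (intro agreement_small_cubic) simp_all
      then show ?thesis by (simp add: p eq_commute[of "ratfun_eval V U _"])
    next
      assume "p \<notin> small_PRF_pairs" "p' \<notin> small_PRF_pairs"
      then have VU: "(V, U) \<in> S" "(V', U') \<in> S" using that by (auto simp: p K_def)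
      from S have "card {x. ratfun_eval V U x = ratfun_eval V' U' x} \<le> 5"
      proof
        assume "S = monic_PRF_pairs 3 2"
        then show ?thesis using VU W by (intro agreement_monic_cubic) simp_all
      next
        assume "S = PRF_pairs 3 0"
        then show ?thesis using VU W by (intro agreement_cubic_poly) simp_all
      qed
      then show ?thesis by (simp add: p)
    qed
  qed
  have card_option: "card (UNIV :: 'a option set) = card (UNIV :: 'a set) + 1"
    by (simp add: UNIV_option_conv card_image)
  have dist: "card (UNIV :: 'a set) - 4 \<le> card {x. ?ev p x \<noteq> ?ev p' x}"
    if "p \<in> K" "p' \<in> K" "p \<noteq> p'" for p p'
  proof -
    have "card (UNIV :: 'a option set) = card ({x. ?ev p x = ?ev p' x} \<union> {x. ?ev p x \<noteq> ?ev p' x})"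
      by (rule arg_cong[of _ _ card]) auto
    also have "\<dots> = card {x. ?ev p x = ?ev p' x} + card {x. ?ev p x \<noteq> ?ev p' x}"
      by (rule card_Un_disjoint) auto
    finally show ?thesis using agree[OF that] card_option by simp
  qed
  \<comment> \<open>Since \<open>q - 4\<close> is positive, different pairs give different
    permutations, so no element of \<open>K\<close> is lost by evaluation.\<close>
  have "inj_on ?ev K"
  proof (rule inj_onI, rule ccontr)
    fix p p' assume "p \<in> K" "p' \<in> K" "?ev p = ?ev p'" "p \<noteq> p'"
    then show False using dist[of p p'] q by simp
  qed
  then have "card K = card (?ev ` K)" by (simp add: card_image)
  also have "\<dots> \<le> M (card (UNIV :: 'a set) + 1) (card (UNIV :: 'a set) - 4)"
  proof (rule card_le_M[OF card_option])
    show "bij f" if "f \<in> ?ev ` K" for f using that K by (auto simp: is_PRF_def)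
    show "card (UNIV :: 'a set) - 4 \<le> card {x. f x \<noteq> g x}"
      if "f \<in> ?ev ` K" "g \<in> ?ev ` K" "f \<noteq> g" for f g
      using that dist by blast
  qed
  finally show ?thesis by (simp add: card_K)
qed

section \<open>Functions of degree at most two\<close>

lemma one_eq_minus_one_imp:
  assumes "(1 :: 'a::ring_1) = - 1"
  shows "(2 :: 'a) = 0"
proof -
  have "(2 :: 'a) = 1 + 1" by simp
  also have "1 + 1 = 1 + (- 1 :: 'a)" using assms by (rule arg_cong)
  finally show ?thesis by simp
qed

lemma monic_linear:
  assumes "degree p = 1" "lead_coeff p = 1"
  obtains b where "p = [:b, 1:]"
  using assms by (elim degree1_coeffs) simp

lemma is_PRF_iff_inj:
  fixes V :: "'a::{field,finite} poly"
  shows "is_PRF V U \<longleftrightarrow> V \<noteq> 0 \<and> U \<noteq> 0 \<and> coprime V U \<and> inj (ratfun_eval V U)"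
  unfolding is_PRF_def bij_def by (auto simp: finite_UNIV_inj_surj)

text \<open>A monic constant denominator is 1, and a polynomial of positive degree fixes infinity,
  so only its values on the field matter.\<close>

lemma PRF_pairs_poly:
  fixes v :: nat
  assumes "0 < v"
  shows "PRF_pairs v 0 = (\<lambda>V :: 'a::{field,finite} poly. (V, 1)) ` {V. degree V = v \<and> inj (poly V)}"
proof -
  have ev: "ratfun_eval V 1 x = map_option (poly V) x" if "degree V = v" for V :: "'a poly" and x
    using that assms by (auto simp: ratfun_eval_def split: option.split)
  have "is_PRF V 1 \<longleftrightarrow> inj (poly V)" if "degree V = v" for V :: "'a poly"
  proof -
    have "V \<noteq> 0" using that assms by auto
    moreover have "ratfun_eval V 1 = map_option (poly V)" using ev[OF that] by auto
    moreover have "inj (map_option (poly V)) \<longleftrightarrow> inj (poly V)"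
    proof
      assume i: "inj (map_option (poly V))"
      show "inj (poly V)"
      proof (rule injI)
        fix x y assume "poly V x = poly V y"
        then have "map_option (poly V) (Some x) = map_option (poly V) (Some y)" by simp
        then show "x = y" using injD[OF i] by blast
      qed
    qed (rule option.inj_map)
    ultimately show ?thesis by (simp add: is_PRF_iff_inj)
  qed
  moreover have "U = 1" if "degree U = 0" "lead_coeff U = 1" for U :: "'a poly"
    using that by (metis degree_eq_zeroE lead_coeff_pCons(2) one_pCons)
  moreover have "degree (1 :: 'a poly) = 0" "lead_coeff (1 :: 'a poly) = 1" by simp_all
  ultimately have "(V, U) \<in> PRF_pairs v 0 \<longleftrightarrow> U = 1 \<and> degree V = v \<and> inj (poly V)" for V U :: "'a poly"
    unfolding PRF_pairs_def mem_Collect_eq prod.case by metis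
  then show ?thesis by auto
qed

lemma card_PRF_pairs_poly:
  assumes "0 < v"
  shows "card (PRF_pairs v 0 :: ('a::{field,finite} poly \<times> 'a poly) set)
    = card {V :: 'a poly. degree V = v \<and> inj (poly V)}"
  unfolding PRF_pairs_poly[OF assms] by (rule card_image) (auto intro: inj_onI)

lemma PRF_pairs_0_0: "PRF_pairs 0 0 = ({} :: ('a::{field,finite} poly \<times> 'a poly) set)"
proof -
  have False if VU: "(V, U) \<in> PRF_pairs 0 0" for V U :: "'a poly"
  proof -
    obtain a b where "V = [:a:]" "U = [:b:]"
      using VU by (auto simp: PRF_pairs_def elim!: degree_eq_zeroE)
    then have "ratfun_eval V U None = ratfun_eval V U (Some 0)"
      using VU by (simp add: ratfun_eval_def PRF_pairs_def)
    moreover have "inj (ratfun_eval V U)" using VU by (auto simp: PRF_pairs_def is_PRF_iff_inj)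
    ultimately show False by (auto dest: injD)
  qed
  then show ?thesis by auto
qed

text \<open>The root of the linear denominator and the point at infinity are two distinct
  poles.\<close>

lemma PRF_pairs_2_1: "PRF_pairs 2 1 = ({} :: ('a::{field,finite} poly \<times> 'a poly) set)"
proof -
  have False if VU: "(V, U) \<in> PRF_pairs 2 1" for V U :: "'a poly"
  proof -
    have "degree U = 1" "lead_coeff U = 1" using VU by (auto simp: PRF_pairs_def)
    then obtain b where U: "U = [:b, 1:]" by (rule monic_linear)
    then have "ratfun_eval V U None = ratfun_eval V U (Some (- b))"
      using VU by (simp add: ratfun_eval_def PRF_pairs_def)
    moreover have "inj (ratfun_eval V U)" using VU by (auto simp: PRF_pairs_def is_PRF_iff_inj)
    ultimately show False by (auto dest: injD)
  qed
  then show ?thesis by auto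
qed

text \<open>The fraction \<open>a + c / (x - r)\<^sup>u\<close>.\<close>

definition pole_pair :: "nat \<Rightarrow> 'a::field \<Rightarrow> 'a \<Rightarrow> 'a \<Rightarrow> 'a poly \<times> 'a poly" where
  "pole_pair u r a c = (smult a ([:- r, 1:] ^ u) + [:c:], [:- r, 1:] ^ u)"

text \<open>The denominator vanishes only at \<open>r\<close>, and \<open>a\<close> is the
  coefficient of exponent \<open>u\<close> in the numerator, because for positive \<open>u\<close>
  the constant \<open>c\<close> does not reach it.\<close>

lemma pole_pair_eq_iff:
  fixes r :: "'a::field"
  assumes "0 < u"
  shows "pole_pair u r a c = pole_pair u r' a' c' \<longleftrightarrow> r = r' \<and> a = a' \<and> c = c'"
proof
  assume eq: "pole_pair u r a c = pole_pair u r' a' c'"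
  then have "[:- r, 1:] ^ u = [:- r', 1:] ^ u" by (simp add: pole_pair_def)
  then have "poly ([:- r, 1:] ^ u) r = poly ([:- r', 1:] ^ u) r" by simp
  then have "(r - r') ^ u = 0" using assms by (simp add: power_0_left)
  then have r: "r = r'" by simp
  have lead: "coeff ([:- r, 1:] ^ u) u = 1"
    by (rule coeff_linear_power)
  have "coeff (fst (pole_pair u r a c)) u = coeff (fst (pole_pair u r' a' c')) u" by (simp add: eq)
  then have "a = a'" using lead assms r by (cases u) (auto simp: pole_pair_def)
  then show "r = r' \<and> a = a' \<and> c = c'" using eq r by (simp add: pole_pair_def)
qed simp

text \<open>Infinity goes to \<open>a\<close>, the pole \<open>r\<close> to infinity, and the
  remaining points are separated because the power map is injective. For \<open>a = 0\<close> the
  numerator is the constant \<open>c\<close>, which is why its degree depends on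
  \<open>a\<close>.\<close>

lemma pole_pair_in_PRF_pairs:
  fixes r :: "'a::{field,finite}"
  assumes u: "0 < u" and inj: "inj (\<lambda>x::'a. x ^ u)" and "c \<noteq> 0"
  shows "pole_pair u r a c \<in> PRF_pairs (if a = 0 then 0 else u) u"
proof -
  define U where "U = [:- r, 1:] ^ u"
  define V where "V = smult a U + [:c:]"
  have dU: "degree U = u" by (simp add: U_def degree_power_eq)
  have lU: "lead_coeff U = 1" by (simp add: U_def lead_coeff_power)
  have dV: "degree V = (if a = 0 then 0 else u)"
    using u by (auto simp: V_def dU degree_add_eq_left)
  have lV: "lead_coeff V = a" if "a \<noteq> 0"
  proof -
    have "coeff V u = a" using u lU by (cases u) (auto simp: V_def dU)
    then show ?thesis using dV that by simp
  qed
  have U0: "poly U x = (x - r) ^ u" for x by (simp add: U_def)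
  have V0: "poly V x = a * (x - r) ^ u + c" for x by (simp add: V_def U0)
  have None: "ratfun_eval V U None = Some a"
    using u lU lV dV dU by (auto simp: ratfun_eval_def)
  have Some: "ratfun_eval V U (Some x) = (if x = r then None else Some (a + c / (x - r) ^ u))" for x
    using u by (auto simp: ratfun_eval_def U0 V0 field_simps)
  have "inj (ratfun_eval V U)"
  proof (rule injI)
    fix x y assume eq: "ratfun_eval V U x = ratfun_eval V U y"
    have pow: "s = t" if "(s - r) ^ u = (t - r) ^ u" for s t
      using injD[OF inj that] by simp
    show "x = y"
    proof (cases x; cases y)
      fix s t assume "x = Some s" "y = Some t"
      then show ?thesis using eq pow[of s t] \<open>c \<noteq> 0\<close> by (auto simp: Some split: if_splits)
    qed (use eq \<open>c \<noteq> 0\<close> in \<open>auto simp: None Some split: if_splits\<close>)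
  qed
  moreover have "coprime V U"
  proof (rule coprimeI)
    fix d assume "d dvd V" "d dvd U"
    then have "d dvd V - smult a U" by (intro dvd_diff dvd_smult)
    then have "d dvd [:c:]" by (simp add: V_def)
    moreover have "is_unit [:c:]" using \<open>c \<noteq> 0\<close> by (simp add: is_unit_const_poly_iff dvd_field_iff)
    ultimately show "is_unit d" by (rule dvd_unit_imp_unit)
  qed
  moreover have "U \<noteq> 0" "V \<noteq> 0"
    using lU V0[of r] u \<open>c \<noteq> 0\<close> by (auto simp: power_0_left)
  ultimately have "is_PRF V U" by (simp add: is_PRF_iff_inj)
  then show ?thesis using dU dV lU by (simp add: PRF_pairs_def pole_pair_def U_def V_def)
qed

text \<open>Infinity has a finite value \<open>a\<close>, so surjectivity yields a finite pole and
  injectivity makes it the only root of \<open>U\<close>. The remainder \<open>R = V - a U\<close>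
  has no root: at the pole it would contradict coprimality, elsewhere the value \<open>a\<close>
  would be repeated. As its degree is below \<open>u\<close>, hence at most 1, it is
  constant.\<close>

lemma pole_pair_of_PRF_pairs:
  fixes V U :: "'a::{field,finite} poly"
  assumes VU: "(V, U) \<in> PRF_pairs v u" and "v \<le> u" and u: "u = 1 \<or> u = 2"
  shows "\<exists>r a c. (V, U) = pole_pair u r a c \<and> c \<noteq> 0 \<and> v = (if a = 0 then 0 else u) \<and> inj (\<lambda>x::'a. x ^ u)"
proof -
  have PRF: "is_PRF V U" and dV: "degree V = v" and dU: "degree U = u" and lU: "lead_coeff U = 1"
    using VU by (auto simp: PRF_pairs_def)
  have inj: "inj (ratfun_eval V U)" and surj: "surj (ratfun_eval V U)" and cop: "coprime V U"
    using PRF by (auto simp: is_PRF_def bij_def)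
  have "U \<noteq> 0" using lU by auto
  \<comment> \<open>This is the leading coefficient of \<open>V\<close> if \<open>v = u\<close> and
    0 if \<open>v < u\<close>, matching both cases of the value at infinity.\<close>
  define a where "a = coeff V u"
  have None: "ratfun_eval V U None = Some a"
    using \<open>v \<le> u\<close> lU by (auto simp: ratfun_eval_def a_def dV dU coeff_eq_0)
  obtain y where y: "ratfun_eval V U y = None" using surj by (metis surj_def)
  then obtain r where r: "poly U r = 0"
    using None by (cases y) (auto simp: ratfun_eval_def split: if_splits)
  have only_root: "s = r" if "poly U s = 0" for s
  proof -
    have "ratfun_eval V U (Some s) = ratfun_eval V U (Some r)"
      using that r by (simp add: ratfun_eval_def)
    then show ?thesis using injD[OF inj] by blast
  qed
  have U: "U = [:- r, 1:] ^ u"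
    using u
  proof
    assume "u = 1"
    then obtain b where "U = [:b, 1:]" using dU lU monic_linear[of U] by auto
    then show ?thesis using r \<open>u = 1\<close> by (simp add: add_eq_0_iff)
  next
    assume "u = 2"
    obtain W where W: "U = [:- r, 1:] * W" using r by (auto simp: poly_eq_0_iff_dvd)
    then have "W \<noteq> 0" using \<open>U \<noteq> 0\<close> by auto
    then have "degree U = Suc (degree W)" unfolding W by (subst degree_mult_eq) auto
    then have "degree W = 1" using dU \<open>u = 2\<close> by simp
    moreover have "lead_coeff W = 1" using lU unfolding W lead_coeff_mult by simp
    ultimately obtain b where b: "W = [:b, 1:]" by (rule monic_linear)
    then have "- b = r" by (intro only_root) (simp add: W)
    then have "b = - r" by (rule subst) simp
    then show ?thesis unfolding W b \<open>u = 2\<close> by (simp only: power2_eq_square)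
  qed
  define R where "R = V - smult a U"
  have R_root: "poly R s \<noteq> 0" for s
  proof
    assume R0: "poly R s = 0"
    show False
    proof (cases "poly U s = 0")
      case True
      then show False using R0 coprime_poly_0[OF cop, of s] by (auto simp: R_def)
    next
      case False
      then have "ratfun_eval V U (Some s) = ratfun_eval V U None"
        using R0 None by (simp add: ratfun_eval_def R_def)
      then show False using injD[OF inj] by blast
    qed
  qed
  have "degree R < u"
  proof -
    have "degree R \<le> u" unfolding R_def using dV dU \<open>v \<le> u\<close>
      by (intro degree_diff_le) (simp_all add: degree_smult_eq)
    moreover have "degree R \<noteq> u"
    proof
      assume "degree R = u"
      then have "lead_coeff R = 0" using lU dU by (simp add: R_def a_def)
      then show False using R_root[of 0] by (simp add: leading_coeff_0_iff)
    qed
    ultimately show ?thesis by simp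
  qed
  moreover have "degree R \<noteq> 1"
  proof
    assume "degree R = 1"
    then obtain d e where "R = [:e, d:]" "d \<noteq> 0" by (rule degree1_coeffs)
    then have "poly R (- e / d) = 0" by simp
    then show False using R_root by blast
  qed
  ultimately have "degree R = 0" using u by auto
  then obtain c where c: "R = [:c:]" by (rule degree_eq_zeroE)
  then have "c \<noteq> 0" using R_root[of 0] by auto
  have V: "V = smult a U + [:c:]" using c by (simp add: R_def algebra_simps)
  have v: "v = (if a = 0 then 0 else u)"
    using u dV dU by (auto simp: V degree_add_eq_left)
  have "inj (\<lambda>x::'a. x ^ u)"
  proof (rule injI)
    fix x y :: 'a assume eq: "x ^ u = y ^ u"
    have "ratfun_eval V U (Some (x + r)) = ratfun_eval V U (Some (y + r))"
      using eq by (simp add: ratfun_eval_def V U)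
    then show "x = y" using injD[OF inj] by (metis add_right_cancel option.inject)
  qed
  then show ?thesis using V U v \<open>c \<noteq> 0\<close> by (auto simp: pole_pair_def)
qed

lemma card_PRF_pairs_0_u:
  assumes u: "u = 1 \<or> u = 2" and inj: "inj (\<lambda>x::'a::{field,finite}. x ^ u)"
  shows "card (PRF_pairs 0 u :: ('a poly \<times> 'a poly) set) = card (UNIV :: 'a set) * (card (UNIV :: 'a set) - 1)"
proof -
  have "(PRF_pairs 0 u :: ('a poly \<times> 'a poly) set) = (\<lambda>(r, c). pole_pair u r 0 c) ` (UNIV \<times> (UNIV - {0}))"
  proof (intro equalityI subsetI)
    fix p :: "'a poly \<times> 'a poly" assume "p \<in> PRF_pairs 0 u"
    then obtain r a c where "p = pole_pair u r a c" "c \<noteq> 0" "0 = (if a = 0 then 0 else u)"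
      using pole_pair_of_PRF_pairs[of "fst p" "snd p" 0 u] u by auto
    then show "p \<in> (\<lambda>(r, c). pole_pair u r 0 c) ` (UNIV \<times> (UNIV - {0}))"
      using u by (intro image_eqI[of _ _ "(r, c)"]) (auto split: if_splits)
  next
    fix p :: "'a poly \<times> 'a poly" assume "p \<in> (\<lambda>(r, c). pole_pair u r 0 c) ` (UNIV \<times> (UNIV - {0}))"
    then obtain r c where "p = pole_pair u r 0 c" "c \<noteq> 0" by auto
    then show "p \<in> PRF_pairs 0 u"
      using pole_pair_in_PRF_pairs[OF _ inj, of c r 0] u by auto
  qed
  moreover have "inj_on (\<lambda>(r, c). pole_pair u r 0 c) (UNIV \<times> (UNIV - {0 :: 'a}))"
    using u by (auto intro!: inj_onI simp: pole_pair_eq_iff)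
  ultimately show ?thesis by (simp add: card_image card_cartesian_product)
qed

lemma card_PRF_pairs_u_u:
  assumes u: "u = 1 \<or> u = 2" and inj: "inj (\<lambda>x::'a::{field,finite}. x ^ u)"
  shows "card (PRF_pairs u u :: ('a poly \<times> 'a poly) set)
    = card (UNIV :: 'a set) * ((card (UNIV :: 'a set) - 1) * (card (UNIV :: 'a set) - 1))"
proof -
  let ?S = "UNIV \<times> (UNIV - {0}) \<times> (UNIV - {0}) :: ('a \<times> 'a \<times> 'a) set"
  have "(PRF_pairs u u :: ('a poly \<times> 'a poly) set) = (\<lambda>(r, a, c). pole_pair u r a c) ` ?S"
  proof (intro equalityI subsetI)
    fix p :: "'a poly \<times> 'a poly" assume "p \<in> PRF_pairs u u"
    then obtain r a c where "p = pole_pair u r a c" "c \<noteq> 0" "u = (if a = 0 then 0 else u)"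
      using pole_pair_of_PRF_pairs[of "fst p" "snd p" u u] u by auto
    then show "p \<in> (\<lambda>(r, a, c). pole_pair u r a c) ` ?S"
      using u by (intro image_eqI[of _ _ "(r, a, c)"]) (auto split: if_splits)
  next
    fix p :: "'a poly \<times> 'a poly" assume "p \<in> (\<lambda>(r, a, c). pole_pair u r a c) ` ?S"
    then obtain r a c where "p = pole_pair u r a c" "a \<noteq> 0" "c \<noteq> 0" by auto
    then show "p \<in> PRF_pairs u u"
      using pole_pair_in_PRF_pairs[OF _ inj, of c r a] u by auto
  qed
  moreover have "inj_on (\<lambda>(r, a, c). pole_pair u r a c) ?S"
    using u by (auto intro!: inj_onI simp: pole_pair_eq_iff)
  ultimately show ?thesis by (simp add: card_image card_cartesian_product)
qed

lemma PRF_pairs_1_2: "PRF_pairs 1 2 = ({} :: ('a::{field,finite} poly \<times> 'a poly) set)"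
proof -
  have "(V, U) \<notin> PRF_pairs 1 2" for V U :: "'a poly"
    using pole_pair_of_PRF_pairs[of V U 1 2] by (auto split: if_splits)
  then show ?thesis by auto
qed

lemma PRF_pairs_u_2_empty:
  assumes "(2 :: 'a::{field,finite}) \<noteq> 0" "v \<le> 2"
  shows "PRF_pairs v 2 = ({} :: ('a poly \<times> 'a poly) set)"
proof -
  have "\<not> inj (\<lambda>x::'a. x ^ 2)"
  proof
    assume "inj (\<lambda>x::'a. x ^ 2)"
    then have "1 = (-1 :: 'a)" by (rule injD) simp
    then show False using assms by (auto dest: one_eq_minus_one_imp)
  qed
  then have "(V, U) \<notin> PRF_pairs v 2" for V U :: "'a poly"
    using pole_pair_of_PRF_pairs[of V U v 2] assms(2) by auto
  then show ?thesis by auto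
qed

section \<open>Permutation polynomials of degree one and two\<close>

lemma degree_one_inj_eq:
  "{V :: 'a::field poly. degree V = 1 \<and> inj (poly V)} = (\<lambda>(b, a). [:b, a:]) ` (UNIV \<times> (UNIV - {0}))"
proof (intro equalityI subsetI)
  fix V :: "'a poly" assume "V \<in> {V. degree V = 1 \<and> inj (poly V)}"
  then have "degree V = 1" by simp
  then obtain a b where "V = [:b, a:]" "a \<noteq> 0" by (rule degree1_coeffs)
  then show "V \<in> (\<lambda>(b, a). [:b, a:]) ` (UNIV \<times> (UNIV - {0}))"
    by (intro image_eqI[of _ _ "(b, a)"]) simp_all
next
  fix V :: "'a poly" assume "V \<in> (\<lambda>(b, a). [:b, a:]) ` (UNIV \<times> (UNIV - {0}))"
  then show "V \<in> {V. degree V = 1 \<and> inj (poly V)}" by (auto intro!: injI)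
qed

lemma card_PRF_pairs_1_0:
  "card (PRF_pairs 1 0 :: ('a::{field,finite} poly \<times> 'a poly) set)
    = card (UNIV :: 'a set) * (card (UNIV :: 'a set) - 1)"
proof -
  have "inj_on (\<lambda>(b, a). [:b, a :: 'a:]) (UNIV \<times> (UNIV - {0}))" by (rule inj_onI) auto
  then show ?thesis
    by (simp only: card_PRF_pairs_poly zero_less_one degree_one_inj_eq card_image) (simp add: card_cartesian_product)
qed

text \<open>The points 0 and \<open>- b / a\<close> share the value \<open>c\<close>, so they
  coincide; without linear term 1 and -1 share a value as well.\<close>

lemma inj_quadratic_imp:
  fixes a :: "'a::field"
  assumes "a \<noteq> 0" "inj (poly [:c, b, a:])"
  shows "b = 0" and "(2 :: 'a) = 0"
proof -
  have "poly [:c, b, a:] 0 = poly [:c, b, a:] (- b / a)" using assms(1) by simp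
  then have "0 = - b / a" by (rule injD[OF assms(2)])
  then show "b = 0" using assms(1) by simp
  then have "poly [:c, b, a:] 1 = poly [:c, b, a:] (- 1)" by simp
  then have "1 = (- 1 :: 'a)" by (rule injD[OF assms(2)])
  then show "(2 :: 'a) = 0" by (rule one_eq_minus_one_imp)
qed

lemma degree_two_inj_eq:
  assumes "(2 :: 'a::field) = 0"
  shows "{V :: 'a poly. degree V = 2 \<and> inj (poly V)} = (\<lambda>(c, a). [:c, 0, a:]) ` (UNIV \<times> (UNIV - {0}))"
proof (intro equalityI subsetI)
  fix V :: "'a poly" assume "V \<in> {V. degree V = 2 \<and> inj (poly V)}"
  then have V: "degree V = 2" "inj (poly V)" by simp_all
  obtain a b c where abc: "V = [:c, b, a:]" "a \<noteq> 0" using V(1) by (rule degree2_coeffs)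
  then have "b = 0" using inj_quadratic_imp(1) V(2) by blast
  then show "V \<in> (\<lambda>(c, a). [:c, 0, a:]) ` (UNIV \<times> (UNIV - {0}))"
    using abc by (intro image_eqI[of _ _ "(c, a)"]) simp_all
next
  fix V :: "'a poly" assume "V \<in> (\<lambda>(c, a). [:c, 0, a:]) ` (UNIV \<times> (UNIV - {0}))"
  then obtain a c where V: "V = [:c, 0, a:]" "a \<noteq> 0" by auto
  have "inj (poly V)"
  proof (rule injI)
    fix x y assume "poly V x = poly V y"
    then have "x ^ 2 = y ^ 2" using V by (simp add: power2_eq_square)
    then show "x = y" by (rule injD[OF char_two_square_inj[OF assms]])
  qed
  then show "V \<in> {V. degree V = 2 \<and> inj (poly V)}" using V by simp
qed

lemma card_PRF_pairs_2_0:
  "card (PRF_pairs 2 0 :: ('a::{field,finite} poly \<times> 'a poly) set)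
    = (if (2 :: 'a) = 0 then card (UNIV :: 'a set) * (card (UNIV :: 'a set) - 1) else 0)"
proof (cases "(2 :: 'a) = 0")
  case True
  have "inj_on (\<lambda>(c, a). [:c, 0, a :: 'a:]) (UNIV \<times> (UNIV - {0}))" by (rule inj_onI) auto
  then show ?thesis
    by (simp only: card_PRF_pairs_poly zero_less_numeral degree_two_inj_eq[OF True] card_image)
      (simp add: card_cartesian_product True)
next
  case False
  have "\<not> (degree V = 2 \<and> inj (poly V))" for V :: "'a poly"
    using inj_quadratic_imp(2) False degree2_coeffs[of V] by metis
  then have "{V :: 'a poly. degree V = 2 \<and> inj (poly V)} = {}" by blast
  then show ?thesis using False by (simp only: card_PRF_pairs_poly zero_less_numeral) simp
qed

text \<open>The types (1, 0), (0, 1) and (1, 1) make up the \<open>q ^ 3 - q\<close> fractional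
  linear maps. Characteristic 2 adds equally many of types (2, 0), (0, 2) and (2, 2), and all other
  types are empty.\<close>

lemma T3_eq:
  "real (T3 TYPE('a::{field,finite})) =
    (if (2 :: 'a) = 0 then 2 else 1) * (real (card (UNIV :: 'a set)) ^ 3 - real (card (UNIV :: 'a set)))"
proof -
  let ?q = "card (UNIV :: 'a set)"
  \<comment> \<open>Writing the order as a successor removes the truncated subtraction from the
    counts.\<close>
  obtain m where q: "?q = Suc m"
    using one_less_card_UNIV[where 'a = 'a] by (cases ?q) simp_all
  have set: "{0..2::nat} = {0, 1, 2}" by auto
  have inj1: "inj (\<lambda>x::'a. x ^ 1)" by (auto intro: injI)
  have T3: "T3 TYPE('a) = (\<Sum>v\<in>{0, 1, 2}. \<Sum>u\<in>{0, 1, 2}. card (PRF_pairs v u :: ('a poly \<times> 'a poly) set))"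
    by (simp only: T3_def N_eq_card set sum.cartesian_product)
  note c = card_PRF_pairs_1_0[where 'a = 'a] card_PRF_pairs_2_0[where 'a = 'a]
    PRF_pairs_0_0[where 'a = 'a] PRF_pairs_2_1[where 'a = 'a] PRF_pairs_1_2[where 'a = 'a]
    card_PRF_pairs_0_u[of 1, OF _ inj1] card_PRF_pairs_u_u[of 1, OF _ inj1]
  show ?thesis
  proof (cases "(2 :: 'a) = 0")
    case True
    note inj2 = char_two_square_inj[OF True]
    note c2 = card_PRF_pairs_0_u[of 2, OF _ inj2] card_PRF_pairs_u_u[of 2, OF _ inj2]
    show ?thesis unfolding T3 using True
      by (simp add: c[unfolded One_nat_def] c2 q algebra_simps power3_eq_cube)
  next
    case False
    show ?thesis unfolding T3 using False
      by (simp add: c[unfolded One_nat_def] PRF_pairs_u_2_empty q algebra_simps power3_eq_cube)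
  qed
qed

section \<open>Functions of type (3, 2)\<close>

lemma card_image_two_to_one:
  assumes "finite A" "\<And>x. x \<in> A \<Longrightarrow> card {y \<in> A. f y = f x} = 2"
  shows "card A = 2 * card (f ` A)"
proof -
  have "card A = (\<Sum>x\<in>A. 1)" by simp
  also have "\<dots> = (\<Sum>y\<in>f ` A. \<Sum>x\<in>{x \<in> A. f x = y}. 1)" by (rule sum.image_gen[OF assms(1)])
  also have "\<dots> = (\<Sum>y\<in>f ` A. 2)"
  proof (rule sum.cong[OF refl])
    fix y assume "y \<in> f ` A"
    then obtain x where "x \<in> A" "y = f x" by blast
    then show "(\<Sum>x\<in>{x \<in> A. f x = y}. 1) = (2 :: nat)" using assms(2)[of x] by simp
  qed
  finally show ?thesis by simp
qed

lemma quadratic_coeffs_eq_iff: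
  fixes r s :: "'a::field"
  shows "- r - s = - r' - s' \<and> r * s = r' * s' \<longleftrightarrow> (r' = r \<and> s' = s) \<or> (r' = s \<and> s' = r)"
proof
  assume *: "- r - s = - r' - s' \<and> r * s = r' * s'"
  have "r + s = - (- r - s)" by simp
  also have "\<dots> = - (- r' - s')" using * by (simp only:)
  also have "\<dots> = r' + s'" by simp
  finally have eq: "r + s = r' + s'" "r * s = r' * s'" using * by simp_all
  have "(r' - r) * (r' - s) = r' * r' - r' * (r + s) + r * s" by (simp add: algebra_simps)
  also have "\<dots> = 0" by (simp add: eq algebra_simps)
  finally show "(r' = r \<and> s' = s) \<or> (r' = s \<and> s' = r)" using eq(1) by auto
qed auto

lemma rootfree_quadratic_iff:
  "rootfree_quadratic t n \<longleftrightarrow> (t, n) \<notin> range (\<lambda>(r, s). (- r - s, r * s))"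
proof -
  have "x ^ 2 + t * x + n = 0 \<longleftrightarrow> (\<exists>s. (t, n) = (- x - s, x * s))" for x
  proof
    assume "x ^ 2 + t * x + n = 0"
    then have "n = - (x * x + t * x)" by (simp add: eq_neg_iff_add_eq_0 power2_eq_square algebra_simps)
    then show "\<exists>s. (t, n) = (- x - s, x * s)"
      by (intro exI[of _ "- (t + x)"]) (simp add: algebra_simps)
  next
    assume "\<exists>s. (t, n) = (- x - s, x * s)"
    then obtain s where "t = - x - s" "n = x * s" by blast
    then show "x ^ 2 + t * x + n = 0" by (simp only:) (simp add: power2_eq_square algebra_simps)
  qed
  then show ?thesis unfolding rootfree_quadratic_def by auto
qed

text \<open>The complement consists of the products \<open>(x - r) (x - s)\<close>. The map from
  pairs of roots to coefficients is injective on the diagonal and two-to-one off it, which gives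
  \<open>q + q (q - 1) / 2\<close> of the \<open>q ^ 2\<close> quadratics.\<close>

lemma card_rootfree_quadratics:
  "2 * card {(t, n). rootfree_quadratic t (n :: 'a::{field,finite})}
    = card (UNIV :: 'a set) * (card (UNIV :: 'a set) - 1)"
proof -
  let ?q = "card (UNIV :: 'a set)"
  define f where "f = (\<lambda>(r :: 'a, s). (- r - s, r * s))"
  let ?d = "range (\<lambda>r :: 'a. (r, r))"
  have f: "f p = f p' \<longleftrightarrow> p' = p \<or> p' = prod.swap p" for p p'
    using quadratic_coeffs_eq_iff[of "fst p" "snd p" "fst p'" "snd p'"]
    by (simp add: f_def split_beta prod_eq_iff)
  have "card ?d = ?q" by (rule card_image) (auto intro: injI)
  have compl: "card (- S) = ?q * ?q - card S" for S :: "('a \<times> 'a) set"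
    using card_Diff_subset[of S UNIV] card_cartesian_product[of "UNIV :: 'a set" "UNIV :: 'a set"]
    by (simp add: Compl_eq_Diff_UNIV)
  have "card (- ?d) = ?q * ?q - ?q" by (simp only: compl \<open>card ?d = ?q\<close>)
  moreover have "card (- ?d) = 2 * card (f ` (- ?d))"
  proof (rule card_image_two_to_one)
    fix p assume p: "p \<in> - ?d"
    then have "{p' \<in> - ?d. f p' = f p} = {p, prod.swap p}"
      by (simp only: f) (auto simp: image_iff prod_eq_iff)
    moreover have "p \<noteq> prod.swap p" using p by (auto simp: prod_eq_iff image_iff)
    ultimately show "card {p' \<in> - ?d. f p' = f p} = 2" by simp
  qed simp
  moreover have "card (f ` ?d) = ?q"
  proof -
    have "inj_on f ?d" by (rule inj_onI) (auto simp only: f swap_simp)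
    then show ?thesis using \<open>card ?d = ?q\<close> by (simp add: card_image)
  qed
  moreover have "card (range f) = card (f ` ?d) + card (f ` (- ?d))"
  proof -
    have "range f = f ` ?d \<union> f ` (- ?d)" by (simp flip: image_Un)
    moreover have "f p \<noteq> f p'" if "p \<in> ?d" "p' \<in> - ?d" for p p'
      unfolding f using that by auto
    then have "f ` ?d \<inter> f ` (- ?d) = {}" by blast
    ultimately show ?thesis by (simp add: card_Un_disjoint)
  qed
  moreover have "card {(t, n). rootfree_quadratic t (n :: 'a)} = ?q * ?q - card (range f)"
  proof -
    have "{(t, n). rootfree_quadratic t (n :: 'a)} = - range f"
      by (auto simp: rootfree_quadratic_iff f_def)
    then show ?thesis
      by (simp only: compl)
  qed
  moreover obtain m where "?q = Suc m"
    using one_less_card_UNIV[where 'a = 'a] by (cases ?q) simp_all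
  ultimately show ?thesis by simp
qed

text \<open>The fraction \<open>x + c - (t\<^sup>2 - 4 n) U' / U\<close>, where \<open>U = x\<^sup>2 + t x + n\<close>.\<close>

definition cubic_pair :: "('a::field \<times> 'a) \<times> 'a \<Rightarrow> 'a poly \<times> 'a poly" where
  "cubic_pair = (\<lambda>((t, n), c).
     ([:c * n - (t ^ 2 - 4 * n) * t, c * t + n - 2 * (t ^ 2 - 4 * n), c + t, 1:], [:n, t, 1:]))"

section \<open>Which monic functions of type (3, 2) permute the projective line\<close>

context rootfree_quadratic
begin

lemma poly_U: "poly [:n, t, 1:] x = U x"
  by (simp add: U_def algebra_simps power2_eq_square)

lemma cubic_pair_in_monic_PRF_pairs: "cubic_pair ((t, n), c) \<in> monic_PRF_pairs 3 2"
proof -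
  define V where "V = [:c * n - D * t, c * t + n - 2 * D, c + t, 1:]"
  let ?U = "[:n, t, 1:]"
  have V: "V = [:c, 1:] * ?U - smult D [:t, 2:]" by (simp add: V_def algebra_simps)
  have poly_V: "poly V x / U x = x + c - D * U' x / U x" for x
  proof -
    have "poly V x = (x + c) * U x - D * U' x"
      unfolding V by (simp only: poly_diff poly_mult poly_U) (simp add: U'_def algebra_simps)
    then show ?thesis by (simp add: diff_divide_distrib)
  qed
  have ev: "ratfun_eval V ?U x = map_option (\<lambda>x. x + c - D * U' x / U x) x" for x
    by (cases x) (simp_all add: ratfun_eval_def poly_U poly_V del: poly_pCons, simp add: V_def)
  have "inj (ratfun_eval V ?U)"
    unfolding ext[of "ratfun_eval V ?U", OF ev] by (rule option.inj_map[OF inj_solution])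
  moreover have "coprime V ?U"
  proof (rule coprimeI)
    fix d assume d: "d dvd V" "d dvd ?U"
    have "d dvd [:c, 1:] * ?U - V" using d by (intro dvd_diff dvd_mult)
    then have "d dvd smult D [:t, 2:]" by (simp only: V) (simp add: algebra_simps)
    then have "d dvd [:t, 2:]" using D_nz by (rule dvd_smult_cancel)
    \<comment> \<open>The identity \<open>U' ^ 2 - 4 U = D\<close> turns a common divisor of
      \<open>U\<close> and \<open>U'\<close> into a divisor of a nonzero constant, in every
      characteristic.\<close>
    then have "d dvd [:t, 2:] * [:t, 2:] - smult 4 ?U" using d by (intro dvd_diff dvd_mult dvd_smult)
    moreover have "[:t, 2:] * [:t, 2:] - smult 4 ?U = [:D:]"
      by (simp add: D_def power2_eq_square)
    ultimately have "d dvd [:D:]" by simp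
    moreover have "is_unit [:D:]" by (simp add: is_unit_const_poly_iff dvd_field_iff)
    ultimately show "is_unit d" by (rule dvd_unit_imp_unit)
  qed
  moreover have "V \<noteq> 0" "degree V = 3" "lead_coeff V = 1" by (simp_all add: V_def)
  ultimately have "(V, ?U) \<in> monic_PRF_pairs 3 2"
    by (simp add: monic_PRF_pairs_def PRF_pairs_def is_PRF_iff_inj)
  then show ?thesis by (simp add: cubic_pair_def V_def D_def)
qed

lemma monic_PRF_pair_imp_cubic_pair:
  assumes VU: "(V, [:n, t, 1:]) \<in> monic_PRF_pairs 3 2" and q: "4 < card (UNIV :: 'a set)"
  shows "\<exists>c. (V, [:n, t, 1:]) = cubic_pair ((t, n), c)"
proof -
  let ?U = "[:n, t, 1:]"
  have "degree V = 3" "lead_coeff V = 1" and inj: "inj (ratfun_eval V ?U)" and cop: "coprime V ?U"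
    using VU by (auto simp: monic_PRF_pairs_def PRF_pairs_def is_PRF_iff_inj)
  obtain v0 W where W: "V = pCons v0 W" by (cases V)
  then have "degree W = 2" using \<open>degree V = 3\<close> by (auto split: if_splits)
  then obtain v1 v2 v3 where "W = [:v1, v2, v3:]" "v3 \<noteq> 0" by (rule degree2_coeffs)
  then have V: "V = [:v0, v1, v2, 1:]" using W \<open>lead_coeff V = 1\<close> by simp
  \<comment> \<open>Division of \<open>V\<close> by \<open>U\<close>: the quotient is
    \<open>x + c\<close>, the remainder \<alpha> x + \<beta>. A zero remainder is excluded below by
    coprimality.\<close>
  define c where "c = v2 - t"
  define \<alpha> where "\<alpha> = v1 - n - c * t"
  define \<beta> where "\<beta> = v0 - c * n"
  have V': "V = [:c, 1:] * ?U + [:\<beta>, \<alpha>:]" by (simp add: V c_def \<alpha>_def \<beta>_def algebra_simps)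
  have "poly V x / U x = x + c + (\<alpha> * x + \<beta>) / U x" for x
  proof -
    have "poly V x = (x + c) * U x + (\<alpha> * x + \<beta>)"
      unfolding V' by (simp only: poly_add poly_mult poly_U) (simp add: algebra_simps)
    then show ?thesis by (simp add: add_divide_distrib)
  qed
  then have ev: "ratfun_eval V ?U (Some x) = Some (x + c + (\<alpha> * x + \<beta>) / U x)" for x
    by (simp add: ratfun_eval_def poly_U del: poly_pCons)
  have "inj (\<lambda>x. x + c + (\<alpha> * x + \<beta>) / U x)"
  proof (rule injI)
    fix x y assume "x + c + (\<alpha> * x + \<beta>) / U x = y + c + (\<alpha> * y + \<beta>) / U y"
    then have "ratfun_eval V ?U (Some x) = ratfun_eval V ?U (Some y)" by (simp only: ev)
    then show "x = y" using injD[OF inj] by blast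
  qed
  moreover have "(\<alpha>, \<beta>) \<noteq> (0, 0)"
  proof
    assume "(\<alpha>, \<beta>) = (0, 0)"
    then have "V = [:c, 1:] * ?U" using V' by simp
    then have "?U dvd V" by (simp only: dvd_triv_right)
    then have "is_unit ?U" using cop by (meson coprime_common_divisor dvd_refl)
    then show False by (simp add: is_unit_iff_degree)
  qed
  ultimately have "\<alpha> = - 2 * D \<and> \<beta> = - D * t" using inj_solution_unique[of c \<alpha> \<beta>] q by blast
  then have "(V, ?U) = cubic_pair ((t, n), c)"
    unfolding cubic_pair_def by (simp add: V c_def \<alpha>_def \<beta>_def D_def algebra_simps)
  then show ?thesis ..
qed

end

lemma card_monic_PRF_pairs_3_2:
  assumes q: "4 < card (UNIV :: 'a::{field,finite} set)"
  shows "2 * card (monic_PRF_pairs 3 2 :: ('a poly \<times> 'a poly) set)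
    = card (UNIV :: 'a set) ^ 2 * (card (UNIV :: 'a set) - 1)"
proof -
  let ?S = "{(t, n). rootfree_quadratic t (n :: 'a)} \<times> UNIV"
  have "(monic_PRF_pairs 3 2 :: ('a poly \<times> 'a poly) set) = cubic_pair ` ?S"
  proof (intro equalityI subsetI)
    fix p :: "'a poly \<times> 'a poly" assume p: "p \<in> monic_PRF_pairs 3 2"
    obtain V U where VU: "p = (V, U)" by (cases p)
    have dU: "degree U = 2" "lead_coeff U = 1" and dV: "degree V = 3" and inj: "inj (ratfun_eval V U)"
      using p by (auto simp: VU monic_PRF_pairs_def PRF_pairs_def is_PRF_iff_inj)
    obtain t n where U: "U = [:n, t, 1:]" using dU by (elim degree2_coeffs) simp
    \<comment> \<open>Infinity is already a pole because the numerator has the larger degree, so a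
      root of \<open>U\<close> would be a second one.\<close>
    have rf: "rootfree_quadratic t n"
    proof
      fix x
      have "poly U x \<noteq> 0"
      proof
        assume "poly U x = 0"
        then have "ratfun_eval V U (Some x) = ratfun_eval V U None"
          using dU dV by (simp add: ratfun_eval_def)
        then show False using injD[OF inj] by blast
      qed
      then show "x ^ 2 + t * x + n \<noteq> 0" by (simp add: U algebra_simps power2_eq_square)
    qed
    then obtain c where "p = cubic_pair ((t, n), c)"
      using rootfree_quadratic.monic_PRF_pair_imp_cubic_pair[OF rf _ q, of V] p by (auto simp: VU U)
    then show "p \<in> cubic_pair ` ?S" using rf by (intro image_eqI[of _ _ "((t, n), c)"]) auto
  next
    fix p :: "'a poly \<times> 'a poly" assume "p \<in> cubic_pair ` ?S"
    then obtain t n c where "rootfree_quadratic t n" "p = cubic_pair ((t, n), c)" by auto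
    then show "p \<in> monic_PRF_pairs 3 2"
      using rootfree_quadratic.cubic_pair_in_monic_PRF_pairs by blast
  qed
  moreover have "inj_on cubic_pair ?S"
    by (rule inj_onI) (auto simp: cubic_pair_def)
  ultimately have "card (monic_PRF_pairs 3 2 :: ('a poly \<times> 'a poly) set)
      = card {(t, n). rootfree_quadratic t (n :: 'a)} * card (UNIV :: 'a set)"
    by (simp add: card_image card_cartesian_product)
  then show ?thesis
    using card_rootfree_quadratics[where 'a = 'a] by (simp add: power2_eq_square mult.assoc[symmetric])
qed

section \<open>Cubic polynomials\<close>

lemma degree3_coeffs:
  fixes p :: "'a::zero poly"
  assumes "degree p = 3"
  obtains a b c d where "p = [:d, c, b, a:]" "a \<noteq> 0"
proof -
  obtain d q where p: "p = pCons d q" by (cases p)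
  then have "degree q = 2" using assms by (auto split: if_splits)
  then obtain a b c where "q = [:c, b, a:]" "a \<noteq> 0" by (rule degree2_coeffs)
  then show thesis using that p by simp
qed

text \<open>The power \<open>V ^ k\<close> has degree exactly q - 1, so its values sum to minus its
  leading coefficient, which is nonzero; for an injective \<open>V\<close> that sum would
  vanish.\<close>

lemma no_cubic_inj_if_3_dvd:
  fixes V :: "'a::{field,finite} poly"
  assumes "card (UNIV :: 'a set) = 3 * k + 1" "degree V = 3"
  shows "\<not> inj (poly V)"
proof
  assume inj: "inj (poly V)"
  have k: "0 < k" using assms(1) one_less_card_UNIV[where 'a = 'a] by (cases k) simp_all
  have V: "V \<noteq> 0" using assms(2) by auto
  have d: "degree (V ^ k) = card (UNIV :: 'a set) - 1" using V assms by (simp add: degree_power_eq)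
  have "0 = (\<Sum>x\<in>UNIV. poly V x ^ k)"
    using sum_power_inj_eq_0[OF inj, of k] k assms(1) by simp
  also have "\<dots> = (\<Sum>x\<in>UNIV. poly (V ^ k) x)" by simp
  also have "\<dots> = - coeff (V ^ k) (card (UNIV :: 'a set) - 1)" by (rule sum_poly_UNIV) (simp add: d)
  also have "\<dots> = - lead_coeff (V ^ k)" by (simp only: d)
  finally show False using V by (simp add: lead_coeff_power)
qed

text \<open>Since \<open>3 * k\<close> is q + 1, the \<open>k\<close>-th power of
  \<open>z ^ 3\<close> is \<open>z ^ 2\<close>. The cube thus determines the square, and the two
  together determine \<open>z\<close>.\<close>

lemma cube_inj:
  assumes q: "card (UNIV :: 'a::{field,finite} set) + 1 = 3 * k"
  shows "inj (\<lambda>x::'a. x ^ 3)"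
proof (rule injI)
  fix x y :: 'a assume eq: "x ^ 3 = y ^ 3"
  have pow: "z ^ 2 = (z ^ 3) ^ k" for z :: 'a
  proof (cases "z = 0")
    case False
    have "3 * k = (card (UNIV :: 'a set) - 1) + 2" using q one_less_card_UNIV[where 'a = 'a] by simp
    then have "(z ^ 3) ^ k = z ^ (card (UNIV :: 'a set) - 1) * z ^ 2"
      by (simp only: power_mult[symmetric] power_add)
    then show ?thesis by (simp only: power_card_minus_1_eq_1[OF False] mult_1_left)
  next
    case True
    then show ?thesis using q by (cases k) simp_all
  qed
  then have sq: "x ^ 2 = y ^ 2" by (simp add: eq)
  have "y ^ 2 * x = x ^ 2 * x" by (simp only: sq)
  also have "\<dots> = y ^ 2 * y" using eq by (simp add: power3_eq_cube power2_eq_square)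
  finally show "x = y" using sq by (cases "y = 0") simp_all
qed

text \<open>In the \<open>k\<close>-th power the exponents are \<open>k + 2 * j\<close>, from
  \<open>k\<close> up to q + 1. The top one acts like the exponent 2, and only
  \<open>j = k - 1\<close>, where the exponent is q - 1, has a nonzero power sum. What survives is
  \<open>k * a ^ (k - 1) * c\<close>.\<close>

lemma cubic_inj_imp_pure:
  fixes a c :: "'a::{field,finite}"
  assumes inj: "inj (\<lambda>x. a * x ^ 3 + c * x)" and "a \<noteq> 0"
    and q: "card (UNIV :: 'a set) + 1 = 3 * k" "4 < card (UNIV :: 'a set)"
  shows "c = 0"
proof -
  let ?q = "card (UNIV :: 'a set)"
  have k: "2 \<le> k" "k < ?q - 1" "?q - 1 = k + 2 * (k - 1)" using q by simp_all
  have s: "(\<Sum>x\<in>UNIV. x ^ (k + 2 * j)) = (if j = k - 1 then - 1 else 0 :: 'a)" if "j \<le> k" for j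
  proof -
    have "j = k \<or> j = k - 1 \<or> j < k - 1" using that by arith
    then consider "j = k" | "j = k - 1" | "j < k - 1" by blast
    then show ?thesis
    proof cases
      case 1
      have "x ^ (k + 2 * k) = x ^ 2" for x :: 'a
      proof (cases "x = 0")
        case False
        have "k + 2 * k = (?q - 1) + 2" using q by simp
        then have "x ^ (k + 2 * k) = x ^ (?q - 1) * x ^ 2" by (simp only: power_add)
        then show ?thesis by (simp only: power_card_minus_1_eq_1[OF False] mult_1_left)
      qed (use k in simp)
      then show ?thesis using 1 k q sum_power_eq_0[of 2, where 'a = 'a] by simp
    next
      case 2
      then have e: "k + 2 * j = ?q - 1" using k by simp
      show ?thesis unfolding e using 2 by (simp add: sum_power_card_minus_1 del: One_nat_def)
    next
      case 3
      then have "k + 2 * j < ?q - 1" using k by simp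
      then show ?thesis using 3 k sum_power_eq_0[of "k + 2 * j", where 'a = 'a] by simp
    qed
  qed
  have "0 = (\<Sum>x\<in>UNIV. (a * x ^ 3 + c * x) ^ k)"
    using sum_power_inj_eq_0[OF inj, of k] k by simp
  also have "\<dots> = (\<Sum>x\<in>UNIV. \<Sum>j\<le>k. of_nat (k choose j) * a ^ j * c ^ (k - j) * x ^ (k + 2 * j))"
  proof (rule sum.cong[OF refl])
    fix x :: 'a
    have "of_nat (k choose j) * (a * x ^ 3) ^ j * (c * x) ^ (k - j)
        = of_nat (k choose j) * a ^ j * c ^ (k - j) * x ^ (k + 2 * j)" if "j \<le> k" for j
    proof -
      have e: "k + 2 * j = 3 * j + (k - j)" using that by simp
      show ?thesis
        unfolding e power_mult_distrib power_add power_mult by (simp only: ac_simps)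
    qed
    then show "(a * x ^ 3 + c * x) ^ k
        = (\<Sum>j\<le>k. of_nat (k choose j) * a ^ j * c ^ (k - j) * x ^ (k + 2 * j))"
      unfolding binomial_ring by (intro sum.cong refl) simp
  qed
  also have "\<dots> = (\<Sum>j\<le>k. \<Sum>x\<in>UNIV. of_nat (k choose j) * a ^ j * c ^ (k - j) * x ^ (k + 2 * j))"
    by (rule sum.swap)
  also have "\<dots> = (\<Sum>j\<le>k. if j = k - 1 then - (of_nat (k choose j) * a ^ j * c ^ (k - j)) else 0)"
    by (rule sum.cong[OF refl]) (simp add: s flip: sum_distrib_left)
  also have "\<dots> = - (of_nat (k choose (k - 1)) * a ^ (k - 1) * c ^ (k - (k - 1)))" by simp
  also have "k choose (k - 1) = k" using k binomial_symmetric[of 1 k] by simp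
  finally have "of_nat k * a ^ (k - 1) * c = 0" using k by simp
  \<comment> \<open>Three times \<open>k\<close> is q + 1, which is 1 in the field.\<close>
  moreover have "(of_nat k :: 'a) \<noteq> 0"
  proof
    assume "(of_nat k :: 'a) = 0"
    then have "of_nat (?q + 1) = (0 :: 'a)" unfolding q(1) by simp
    then show False by (simp add: of_nat_card_UNIV_eq_0)
  qed
  ultimately show "c = 0" using \<open>a \<noteq> 0\<close> by simp
qed

text \<open>As 3 is invertible, the cubic can be completed to \<open>a (x + h) ^ 3\<close> plus a
  linear term in \<open>x + h\<close> and a constant; injectivity kills the linear term. The free
  parameters are \<open>a\<close>, \<open>h\<close> and \<open>e\<close>.\<close>

lemma card_cubic_inj_2_mod_3:
  assumes q: "card (UNIV :: 'a::{field,finite} set) + 1 = 3 * k" "4 < card (UNIV :: 'a set)"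
  shows "card {V :: 'a poly. degree V = 3 \<and> inj (poly V)}
    = (card (UNIV :: 'a set) - 1) * (card (UNIV :: 'a set) * card (UNIV :: 'a set))"
proof -
  have three: "(3 :: 'a) \<noteq> 0"
  proof
    assume "(3 :: 'a) = 0"
    then have "of_nat (card (UNIV :: 'a set) + 1) = (0 :: 'a)" unfolding q(1) by simp
    then show False by (simp add: of_nat_card_UNIV_eq_0)
  qed
  let ?P = "\<lambda>(a :: 'a, h, e). [:e + a * h ^ 3, 3 * a * h ^ 2, 3 * a * h, a:]"
  let ?S = "(UNIV - {0 :: 'a}) \<times> (UNIV :: 'a set) \<times> (UNIV :: 'a set)"
  have poly: "poly (?P (a, h, e)) x = a * (x + h) ^ 3 + e" for a h e x
    by (simp add: algebra_simps power3_eq_cube power2_eq_square)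
  have "{V :: 'a poly. degree V = 3 \<and> inj (poly V)} = ?P ` ?S"
  proof (intro equalityI subsetI)
    fix V :: "'a poly" assume "V \<in> {V. degree V = 3 \<and> inj (poly V)}"
    then have V: "degree V = 3" "inj (poly V)" by simp_all
    obtain a b c d where abcd: "V = [:d, c, b, a:]" "a \<noteq> 0" using V(1) by (rule degree3_coeffs)
    define h where "h = b / (3 * a)"
    define c' where "c' = c - 3 * a * h ^ 2"
    define e where "e = d - a * h ^ 3 - c' * h"
    have b: "b = 3 * a * h" using abcd(2) three by (simp add: h_def)
    have Vx: "poly V x = (a * (x + h) ^ 3 + c' * (x + h)) + e" for x
      by (simp add: abcd(1) b c'_def e_def algebra_simps power3_eq_cube power2_eq_square)
    have "inj (\<lambda>x. a * x ^ 3 + c' * x)"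
    proof (rule injI)
      fix x y assume "a * x ^ 3 + c' * x = a * y ^ 3 + c' * y"
      then have "poly V (x - h) = poly V (y - h)" by (simp add: Vx)
      then have "x - h = y - h" by (rule injD[OF V(2)])
      then show "x = y" by simp
    qed
    then have "c' = 0" using abcd(2) q by (rule cubic_inj_imp_pure)
    then have "V = ?P (a, h, e)" by (simp add: abcd(1) b e_def) (simp add: c'_def)
    then show "V \<in> ?P ` ?S" using abcd(2) by blast
  next
    fix V :: "'a poly" assume "V \<in> ?P ` ?S"
    then obtain a h e where V: "V = ?P (a, h, e)" "a \<noteq> 0" by auto
    have "inj (poly V)"
    proof (rule injI)
      fix x y assume "poly V x = poly V y"
      then have "(x + h) ^ 3 = (y + h) ^ 3" using V(2) by (simp only: V(1) poly) simp
      then have "x + h = y + h" by (rule injD[OF cube_inj[OF q(1)]])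
      then show "x = y" by simp
    qed
    then show "V \<in> {V. degree V = 3 \<and> inj (poly V)}" using V by simp
  qed
  moreover have "inj_on ?P ?S" by (rule inj_onI) (auto simp: three)
  ultimately show ?thesis by (simp add: card_image card_cartesian_product del: UNIV_Times_UNIV)
qed

section \<open>Cubic polynomials in characteristic 3\<close>

lemma char_three_cubic_inj_iff:
  fixes a :: "'a::{field,finite}"
  assumes three: "(3 :: 'a) = 0" and "a \<noteq> 0"
  shows "inj (poly [:d, c, b, a:]) \<longleftrightarrow> b = 0 \<and> (\<forall>s. s \<noteq> 0 \<longrightarrow> a * s ^ 2 + c \<noteq> 0)"
proof -
  let ?V = "[:d, c, b, a:]"
  \<comment> \<open>Cubing is additive here, so the difference depends on \<open>y\<close> only
    through the quadratic term. For \<open>b = 0\<close> the dependence disappears; for nonzero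
    \<open>b\<close> a suitable \<open>y\<close> makes the second factor vanish.\<close>
  have diff: "poly ?V (y + s) - poly ?V y = s * (a * s ^ 2 + b * (2 * y + s) + c)" for y s
  proof -
    have "poly ?V (y + s) - poly ?V y
        = s * (a * s ^ 2 + b * (2 * y + s) + c) + 3 * (a * (s * y * y + s * s * y))"
      by (simp add: algebra_simps power2_eq_square)
    then show ?thesis by (simp add: three)
  qed
  show ?thesis
  proof
    assume inj: "inj (poly ?V)"
    have nz: "a * s ^ 2 + b * (2 * y + s) + c \<noteq> 0" if "s \<noteq> 0" for s y
    proof
      assume "a * s ^ 2 + b * (2 * y + s) + c = 0"
      then have "poly ?V (y + s) = poly ?V y" using diff[of y s] by simp
      then have "y + s = y" by (rule injD[OF inj])
      then show False using that by simp
    qed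
    have "b = 0"
    proof (rule ccontr)
      assume "b \<noteq> 0"
      have two: "(2 :: 'a) \<noteq> 0"
      proof
        assume "(2 :: 'a) = 0"
        then have "(3 :: 'a) = 1" by (rule char_two)
        then show False using three by simp
      qed
      \<comment> \<open>Chosen so that \<open>y = w / 2\<close> makes the second factor of
        \<open>diff\<close> vanish at \<open>s = 1\<close>.\<close>
      define w where "w = - (a + c) / b - 1"
      define y where "y = w / 2"
      have "2 * y = w" using two by (simp add: y_def)
      then have "2 * y + 1 = - (a + c) / b" by (simp add: w_def)
      then have "a * 1 ^ 2 + b * (2 * y + 1) + c = 0" using \<open>b \<noteq> 0\<close> by simp
      then show False using nz[of 1 y] by simp
    qed
    then show "b = 0 \<and> (\<forall>s. s \<noteq> 0 \<longrightarrow> a * s ^ 2 + c \<noteq> 0)" using nz by simp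
  next
    assume *: "b = 0 \<and> (\<forall>s. s \<noteq> 0 \<longrightarrow> a * s ^ 2 + c \<noteq> 0)"
    show "inj (poly ?V)"
    proof (rule injI, rule ccontr)
      fix x y assume "poly ?V x = poly ?V y" "x \<noteq> y"
      then have "(x - y) * (a * (x - y) ^ 2 + c) = 0" using diff[of y "x - y"] * by simp
      then show False using * \<open>x \<noteq> y\<close> by simp
    qed
  qed
qed

lemma card_nonzero_squares:
  assumes "(2 :: 'a::{field,finite}) \<noteq> 0"
  shows "2 * card ((\<lambda>x::'a. x ^ 2) ` (UNIV - {0})) = card (UNIV :: 'a set) - 1"
proof -
  have "card (UNIV - {0 :: 'a}) = 2 * card ((\<lambda>x::'a. x ^ 2) ` (UNIV - {0}))"
  proof (rule card_image_two_to_one)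
    fix x :: 'a assume x: "x \<in> UNIV - {0}"
    then have "{y \<in> UNIV - {0}. y ^ 2 = x ^ 2} = {x, - x}" by (auto simp: power2_eq_iff)
    moreover have "x \<noteq> - x"
    proof
      assume "x = - x"
      then have "x + x = 0" by (simp only: add_eq_0_iff)
      then have "2 * x = 0" by (simp only: mult_2)
      then show False using x assms by simp
    qed
    ultimately show "card {y \<in> UNIV - {0}. y ^ 2 = x ^ 2} = 2" by simp
  qed simp
  then show ?thesis by simp
qed

lemma card_cubic_inj_char_3:
  assumes three: "(3 :: 'a::{field,finite}) = 0"
  shows "2 * card {V :: 'a poly. degree V = 3 \<and> inj (poly V)}
    = card (UNIV :: 'a set) * ((card (UNIV :: 'a set) - 1) * (card (UNIV :: 'a set) + 1))"
proof -
  let ?q = "card (UNIV :: 'a set)"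
  have two: "(2 :: 'a) \<noteq> 0"
  proof
    assume "(2 :: 'a) = 0"
    then have "(3 :: 'a) = 1" by (rule char_two)
    then show False using three by simp
  qed
  \<comment> \<open>Besides the nonsquares \<open>m\<close> contains 0, as
    \<open>a x ^ 3 + d\<close> is injective in characteristic 3; this accounts for
    \<open>q + 1\<close> instead of \<open>q - 1\<close> in the count.\<close>
  define m where "m = - (\<lambda>x::'a. x ^ 2) ` (UNIV - {0})"
  have card_m: "2 * card m = ?q + 1"
  proof -
    have "card m = ?q - card ((\<lambda>x::'a. x ^ 2) ` (UNIV - {0}))"
      by (simp only: m_def Compl_eq_Diff_UNIV) (simp add: card_Diff_subset)
    then show ?thesis
      using card_nonzero_squares[OF two] one_less_card_UNIV[where 'a = 'a] by simp
  qed
  let ?P = "\<lambda>(a :: 'a, z, d). [:d, - (a * z), 0, a:]"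
  let ?S = "(UNIV - {0 :: 'a}) \<times> m \<times> (UNIV :: 'a set)"
  have m_iff: "(\<forall>s. s \<noteq> 0 \<longrightarrow> a * s ^ 2 + c \<noteq> 0) \<longleftrightarrow> - c / a \<in> m" if "a \<noteq> 0" for a c
  proof -
    have "a * s ^ 2 + c = 0 \<longleftrightarrow> - c / a = s ^ 2" for s
    proof -
      have "a * s ^ 2 + c = a * (s ^ 2 - (- c / a))" using that by (simp add: distrib_left)
      then show ?thesis using that by (simp only: mult_eq_0_iff right_minus_eq) auto
    qed
    then show ?thesis unfolding m_def by auto
  qed
  have "{V :: 'a poly. degree V = 3 \<and> inj (poly V)} = ?P ` ?S"
  proof (intro equalityI subsetI)
    fix V :: "'a poly" assume "V \<in> {V. degree V = 3 \<and> inj (poly V)}"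
    then have V: "degree V = 3" "inj (poly V)" by simp_all
    obtain a b c d where abcd: "V = [:d, c, b, a:]" "a \<noteq> 0" using V(1) by (rule degree3_coeffs)
    then have "b = 0" "- c / a \<in> m"
      using V(2) char_three_cubic_inj_iff[OF three abcd(2), of d c b] m_iff[OF abcd(2)] by simp_all
    then show "V \<in> ?P ` ?S" using abcd by (intro image_eqI[of _ _ "(a, - c / a, d)"]) simp_all
  next
    fix V :: "'a poly" assume "V \<in> ?P ` ?S"
    then obtain a z d where V: "V = [:d, - (a * z), 0, a:]" "a \<noteq> 0" "z \<in> m" by auto
    then have "inj (poly V)"
      using char_three_cubic_inj_iff[OF three V(2), of d "- (a * z)" 0] m_iff[OF V(2), of "- (a * z)"]
      by simp
    then show "V \<in> {V. degree V = 3 \<and> inj (poly V)}" using V by simp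
  qed
  moreover have "inj_on ?P ?S" by (rule inj_onI) auto
  ultimately have "card {V :: 'a poly. degree V = 3 \<and> inj (poly V)} = (?q - 1) * (card m * ?q)"
    by (simp add: card_image card_cartesian_product)
  then have "2 * card {V :: 'a poly. degree V = 3 \<and> inj (poly V)} = (?q - 1) * ((2 * card m) * ?q)"
    by simp
  then show ?thesis by (simp only: card_m) (simp only: ac_simps)
qed

section \<open>The bound\<close>

text \<open>The order is a power of \<open>p\<close>, and it vanishes in the field; a field has no
  nilpotent elements.\<close>

lemma prime_dvd_card_imp_char:
  assumes "primepow (card (UNIV :: 'a::{field,finite} set))" "prime p" "p dvd card (UNIV :: 'a set)"
  shows "(of_nat p :: 'a) = 0"
proof -
  obtain r k where r: "prime r" "card (UNIV :: 'a set) = r ^ k"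
    using assms(1) by (auto simp: primepow_def)
  then have "p = r" using assms(2,3) by (metis prime_dvd_power primes_dvd_imp_eq)
  then have "(of_nat p :: 'a) ^ k = 0"
    using r of_nat_card_UNIV_eq_0[where 'a = 'a] by (simp flip: of_nat_power)
  then show ?thesis by simp
qed

theorem theorem3p12:
  fixes q :: nat
  assumes "primepow q" and "card (UNIV :: 'a::{field,finite} set) = q" and "q > 7"
  shows "M (q + 1) (q - 4) \<ge> T3 TYPE('a) + max (N_monic TYPE('a) 3 2) (N TYPE('a) 3 0) \<and>
    real (T3 TYPE('a) + max (N_monic TYPE('a) 3 2) (N TYPE('a) 3 0)) =
      (if q mod 3 = 0 then 3 / 2 * (real q ^ 3 - real q)
       else if odd q \<and> q mod 3 = 1 then 1 / 2 * (3 * real q ^ 3 - real q ^ 2 - 2 * real q)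
       else if even q \<and> q mod 3 = 1 then 1 / 2 * (5 * real q ^ 3 - real q ^ 2 - 4 * real q)
       else if odd q \<and> q mod 3 = 2 then 2 * real q ^ 3 - real q ^ 2 - real q
       else 3 * real q ^ 3 - real q ^ 2 - 2 * real q)"
proof
  have "T3 TYPE('a) + N_monic TYPE('a) 3 2 \<le> M (q + 1) (q - 4)"
    using card_union_small_le_M[of "monic_PRF_pairs 3 2 :: ('a poly \<times> 'a poly) set"] assms
    by (simp add: N_monic_eq_card)
  moreover have "T3 TYPE('a) + N TYPE('a) 3 0 \<le> M (q + 1) (q - 4)"
    using card_union_small_le_M[of "PRF_pairs 3 0 :: ('a poly \<times> 'a poly) set"] assms
    by (simp add: N_eq_card)
  ultimately show "M (q + 1) (q - 4) \<ge> T3 TYPE('a) + max (N_monic TYPE('a) 3 2) (N TYPE('a) 3 0)"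
    by (simp add: max_def)
next
  have q: "4 < card (UNIV :: 'a set)" using assms by simp
  have char2: "(2 :: 'a) = 0 \<longleftrightarrow> even q"
  proof
    assume "even q"
    then show "(2 :: 'a) = 0" using prime_dvd_card_imp_char[of 2, where 'a = 'a] assms by simp
  next
    assume two: "(2 :: 'a) = 0"
    show "even q"
    proof (rule ccontr)
      assume "odd q"
      then obtain m where "q = 2 * m + 1" by (elim oddE)
      then have "of_nat q = (1 :: 'a)" by (simp add: two)
      then show False using of_nat_card_UNIV_eq_0[where 'a = 'a] assms(2) by simp
    qed
  qed
  have T3: "real (T3 TYPE('a)) = (if even q then 2 else 1) * (real q ^ 3 - real q)"
    using T3_eq[where 'a = 'a] by (simp add: char2 assms(2))
  have q1: "real (q - 1) = real q - 1" using assms(3) by (simp add: of_nat_diff)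
  have Nm: "real (N_monic TYPE('a) 3 2) = (real q ^ 3 - real q ^ 2) / 2"
  proof -
    have "real (2 * N_monic TYPE('a) 3 2) = real (q ^ 2 * (q - 1))"
      using card_monic_PRF_pairs_3_2[OF q] by (simp add: N_monic_eq_card assms(2))
    then show ?thesis using q1 by (simp add: algebra_simps power3_eq_cube power2_eq_square)
  qed
  have N: "N TYPE('a) 3 0 = card {V :: 'a poly. degree V = 3 \<and> inj (poly V)}"
    by (simp add: N_eq_card card_PRF_pairs_poly)
  \<comment> \<open>Parity is recorded along with the count: in characteristic 3 the order is odd,
    so this residue class needs no parity split.\<close>
  have N0: "real (N TYPE('a) 3 0) = (real q ^ 3 - real q) / 2 \<and> odd q" if "q mod 3 = 0"
  proof -
    have three: "(3 :: 'a) = 0"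
      using prime_dvd_card_imp_char[of 3, where 'a = 'a] assms that by (simp add: mod_eq_0_iff_dvd)
    have "odd q"
    proof
      assume "even q"
      then have "(3 :: 'a) = 1" using char2 char_two(1) by blast
      then show False using three by simp
    qed
    moreover have "real (2 * N TYPE('a) 3 0) = real (q * ((q - 1) * (q + 1)))"
      using card_cubic_inj_char_3[OF three] by (simp add: N assms(2))
    then have "real (N TYPE('a) 3 0) = (real q ^ 3 - real q) / 2"
      using q1 by (simp add: algebra_simps power3_eq_cube)
    ultimately show ?thesis by simp
  qed
  have N1: "N TYPE('a) 3 0 = 0" if "q mod 3 = 1"
  proof -
    have "card (UNIV :: 'a set) = 3 * (q div 3) + 1" using that assms(2) mult_div_mod_eq[of 3 q] by simp
    then have "{V :: 'a poly. degree V = 3 \<and> inj (poly V)} = {}" using no_cubic_inj_if_3_dvd by blast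
    then show ?thesis by (simp only: N card.empty)
  qed
  have N2: "real (N TYPE('a) 3 0) = real q ^ 3 - real q ^ 2" if "q mod 3 = 2"
  proof -
    have "card (UNIV :: 'a set) + 1 = 3 * (q div 3 + 1)" using that assms(2) mult_div_mod_eq[of 3 q] by simp
    then have "real (N TYPE('a) 3 0) = real ((q - 1) * (q * q))"
      using card_cubic_inj_2_mod_3[OF _ q] by (simp only: N assms(2))
    then show ?thesis using q1 by (simp add: algebra_simps power3_eq_cube power2_eq_square)
  qed
  have le: "real q \<le> real q ^ 2" "real q ^ 2 \<le> real q ^ 3"
    using assms(3) by (simp_all add: power2_eq_square power3_eq_cube)
  have "q mod 3 = 0 \<or> q mod 3 = 1 \<or> q mod 3 = 2" by linarith
  then show "real (T3 TYPE('a) + max (N_monic TYPE('a) 3 2) (N TYPE('a) 3 0)) =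
      (if q mod 3 = 0 then 3 / 2 * (real q ^ 3 - real q)
       else if odd q \<and> q mod 3 = 1 then 1 / 2 * (3 * real q ^ 3 - real q ^ 2 - 2 * real q)
       else if even q \<and> q mod 3 = 1 then 1 / 2 * (5 * real q ^ 3 - real q ^ 2 - 4 * real q)
       else if odd q \<and> q mod 3 = 2 then 2 * real q ^ 3 - real q ^ 2 - real q
       else 3 * real q ^ 3 - real q ^ 2 - 2 * real q)"
  \<comment> \<open>Cubic polynomials attain the maximum for the residues 0 and 2, functions of type
    (3, 2) for the residue 1.\<close>
  proof (elim disjE)
    assume m: "q mod 3 = 0"
    have "real (max (N_monic TYPE('a) 3 2) (N TYPE('a) 3 0)) = (real q ^ 3 - real q) / 2"
      unfolding of_nat_max Nm N0[OF m, THEN conjunct1] using le by simp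
    then show ?thesis using m N0[OF m] T3 by (simp add: field_simps)
  next
    assume m: "q mod 3 = 1"
    have "real (max (N_monic TYPE('a) 3 2) (N TYPE('a) 3 0)) = (real q ^ 3 - real q ^ 2) / 2"
      unfolding of_nat_max Nm N1[OF m] using le by simp
    then show ?thesis using m T3 by (cases "even q") (simp_all add: field_simps)
  next
    assume m: "q mod 3 = 2"
    have "real (max (N_monic TYPE('a) 3 2) (N TYPE('a) 3 0)) = real q ^ 3 - real q ^ 2"
      unfolding of_nat_max Nm N2[OF m] using le by simp
    then show ?thesis using m T3 by (cases "even q") (simp_all add: field_simps)
  qed
qed

end
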